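(* There are absolute constants $c_0>0$ and $C>0$ such that the following holds. Let $\epsilon,\epsilon',\delta>0$ with $\delta<1$ and $\epsilon\le\delta/4$, let $d\ge2$ be an integer, and let \[ S\le\exp\left(c_0\left(\frac{\sqrt{\delta}}{\sqrt{\epsilon}}\cdot\frac{\log(1/\delta)}{\log(1/\epsilon')}\right)^{1/(d-1)}\right). \] Then for some $n\le C/\epsilon$, with $\alpha=\sqrt{\epsilon/\delta}$, the random variable $\mathbf N_\alpha$ over $\{0,1\}^n$ is $(\epsilon',\delta)$-pseudodense with respect to $\mathcal C(S,d)$, and yet $\mathbf N_\alpha$ is not $\delta$-dense in any random variable that is $\epsilon$-pseudorandom for $\mathcal C(S,d)$.
   Context: $\mathbf N_\alpha$ (for $0\le\alpha\le1/2$) is the product of $n$ independent Bernoulli random variables each equal to $1$ with probability $1/2-\alpha$. $\mathcal C(S,d)$ is the class of Boolean functions $\{0,1\}^n\to\{0,1\}$ computed by circuits of size at most $S$ and depth at most $d$ with unbounded fan-in AND/OR gates and NOT gates. $\mathbf U$ is uniform on $\{0,1\}^n$. For a class $\mathcal F$: $\mathbf Z$ is $(\epsilon',\delta)$-pseudodense if $\delta\,\mathbb E f(\mathbf Z)\le\mathbb E f(\mathbf U)+\epsilon'$ for all $f\in\mathcal F$; $\mathbf X$ is $\epsilon$-pseudorandom if $|\mathbb E f(\mathbf X)-\mathbb E f(\mathbf U)|\le\epsilon$ for all $f\in\mathcal F$; $\mathbf Z$ is $\delta$-dense in $\mathbf X$ if $\delta\Pr[\mathbf Z=z]\le\Pr[\mathbf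 X=z]$ for all $z$. Logarithms are base 2.
   Formalization: The size S is assumed to be at least 2; as stated the claim fails for S = 1 (e.g. δ=9/10, ε=9/40, ε'=1/10, d=2, where N_α is constantly 0 and NOT x_1 violates pseudodensity). *)

theory Defs
  imports "HOL-Probability.Probability"
begin

text \<open>The cube \<open>{0,1}\<^sup>n\<close>: coordinates are indexed by \<open>i < n\<close>, and points are padded with
  \<^term>\<open>False\<close> outside this range, so that they match the points of \<^const>\<open>Pi_pmf\<close> with default
  value \<^term>\<open>False\<close>. A random variable over the cube is given by its law, a
  \<^typ>\<open>(nat \<Rightarrow> bool) pmf\<close> supported on the cube.\<close>

definition cube :: "nat \<Rightarrow> (nat \<Rightarrow> bool) set" where
  "cube n = {x. \<forall>i\<ge>n. \<not> x i}"

definition uniform_cube :: "nat \<Rightarrow> (nat \<Rightarrow> bool) pmf" where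
  "uniform_cube n = pmf_of_set (cube n)"

definition noise :: "nat \<Rightarrow> real \<Rightarrow> (nat \<Rightarrow> bool) pmf" where
  "noise n \<alpha> = Pi_pmf {..<n} False (\<lambda>_. bernoulli_pmf (1/2 - \<alpha>))"

abbreviation expect :: "(nat \<Rightarrow> bool) pmf \<Rightarrow> ((nat \<Rightarrow> bool) \<Rightarrow> bool) \<Rightarrow> real" where
  "expect Z f \<equiv> measure_pmf.expectation Z (\<lambda>x. of_bool (f x))"

text \<open>A circuit is a directed acyclic graph, given by its gates in a topological order together
  with an output wire: \<open>Gate j\<close> is the output of the gate at position \<open>j\<close>, and each gate reads
  only input variables and gates at earlier positions.\<close>

datatype wire = Input nat | Gate nat

datatype gate = AndG "wire list" | OrG "wire list" | NotG wire

fun gate_wires :: "gate \<Rightarrow> wire set" where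
  "gate_wires (AndG ws) = set ws"
| "gate_wires (OrG ws) = set ws"
| "gate_wires (NotG w) = {w}"

fun wire_ok :: "nat \<Rightarrow> nat \<Rightarrow> wire \<Rightarrow> bool" where
  "wire_ok n k (Input i) \<longleftrightarrow> i < n"
| "wire_ok n k (Gate j) \<longleftrightarrow> j < k"

definition wf_circuit :: "nat \<Rightarrow> gate list \<Rightarrow> wire \<Rightarrow> bool" where
  "wf_circuit n gs out \<longleftrightarrow>
     (\<forall>k < length gs. \<forall>w \<in> gate_wires (gs ! k). wire_ok n k w) \<and> wire_ok n (length gs) out"

fun wire_val :: "(nat \<Rightarrow> bool) \<Rightarrow> bool list \<Rightarrow> wire \<Rightarrow> bool" where
  "wire_val x vs (Input i) = x i"
| "wire_val x vs (Gate j) = vs ! j"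

fun gate_val :: "(nat \<Rightarrow> bool) \<Rightarrow> bool list \<Rightarrow> gate \<Rightarrow> bool" where
  "gate_val x vs (AndG ws) \<longleftrightarrow> (\<forall>w \<in> set ws. wire_val x vs w)"
| "gate_val x vs (OrG ws) \<longleftrightarrow> (\<exists>w \<in> set ws. wire_val x vs w)"
| "gate_val x vs (NotG w) \<longleftrightarrow> \<not> wire_val x vs w"

definition circuit_val :: "gate list \<Rightarrow> wire \<Rightarrow> (nat \<Rightarrow> bool) \<Rightarrow> bool" where
  "circuit_val gs out x = wire_val x (foldl (\<lambda>vs g. vs @ [gate_val x vs g]) [] gs) out"

text \<open>Depth is the maximal number of AND/OR gates on a path from an input to the output. As usual
  for constant-depth circuits, NOT gates do not contribute to the depth (so depth 2 contains all
  CNFs and DNFs), whereas the size counts all gates, including NOT gates.\<close>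

fun wire_depth :: "nat list \<Rightarrow> wire \<Rightarrow> nat" where
  "wire_depth ds (Input i) = 0"
| "wire_depth ds (Gate j) = ds ! j"

fun gate_depth :: "nat list \<Rightarrow> gate \<Rightarrow> nat" where
  "gate_depth ds (AndG ws) = Suc (Max (insert 0 (wire_depth ds ` set ws)))"
| "gate_depth ds (OrG ws) = Suc (Max (insert 0 (wire_depth ds ` set ws)))"
| "gate_depth ds (NotG w) = wire_depth ds w"

definition circuit_depth :: "gate list \<Rightarrow> wire \<Rightarrow> nat" where
  "circuit_depth gs out = wire_depth (foldl (\<lambda>ds g. ds @ [gate_depth ds g]) [] gs) out"

definition circuit_class :: "nat \<Rightarrow> nat \<Rightarrow> nat \<Rightarrow> ((nat \<Rightarrow> bool) \<Rightarrow> bool) set" where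
  "circuit_class n S d =
     {f. \<exists>gs out. wf_circuit n gs out \<and> length gs \<le> S \<and> circuit_depth gs out \<le> d \<and>
           (\<forall>x \<in> cube n. f x = circuit_val gs out x)}"

definition pseudodense ::
  "nat \<Rightarrow> ((nat \<Rightarrow> bool) \<Rightarrow> bool) set \<Rightarrow> real \<Rightarrow> real \<Rightarrow> (nat \<Rightarrow> bool) pmf \<Rightarrow> bool" where
  "pseudodense n F \<epsilon>' \<delta> Z \<longleftrightarrow> (\<forall>f \<in> F. \<delta> * expect Z f \<le> expect (uniform_cube n) f + \<epsilon>')"

definition pseudorandom ::
  "nat \<Rightarrow> ((nat \<Rightarrow> bool) \<Rightarrow> bool) set \<Rightarrow> real \<Rightarrow> (nat \<Rightarrow> bool) pmf \<Rightarrow> bool" where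
  "pseudorandom n F \<epsilon> X \<longleftrightarrow> (\<forall>f \<in> F. \<bar>expect X f - expect (uniform_cube n) f\<bar> \<le> \<epsilon>)"

definition dense_in :: "real \<Rightarrow> (nat \<Rightarrow> bool) pmf \<Rightarrow> (nat \<Rightarrow> bool) pmf \<Rightarrow> bool" where
  "dense_in \<delta> Z X \<longleftrightarrow> (\<forall>z. \<delta> * pmf Z z \<le> pmf X z)"

end

(* Proof idea.  Write the alpha-biased distribution as a random restriction with star probability p
   whose stars are then filled with bias beta = alpha / p.  If the restricted function has a decision
   tree of depth t, then biasing the stars raises its acceptance probability by a factor of at most
   (1 + 2 beta)^t, which is at most 1 / delta as long as t <= log (1 / epsilon') and p is as large as
   alpha log (1 / epsilon') / log (1 / delta), up to a constant.  So it suffices that the tree depth D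
   of a restricted circuit satisfies E 4^D <= 2 for p = 1 / O(log S)^(d-1); the exceptional event
   D >= log (1 / epsilon') then has probability at most epsilon'.  The moment bound is obtained one
   circuit level at a time from a multi-switching lemma: up to a common decision tree of small
   exponential moment, all gates of a level become decision trees of depth O(log S).

   Non-density uses the square of s = sum_i (-1)^(x_i).  Its mean is 4 epsilon n^2 / delta or more
   under the biased distribution.  A pseudorandom X fools all ANDs and ORs of three variables; the
   number of constant ordered triples of coordinates is n^3/4 + (3n/4) s^2, whence
   E_X s^2 <= n + (8/3) epsilon n^2.  This is less than 4 epsilon n^2 when n >= 1 / epsilon.
   (Pairs of variables would only give n + 4 epsilon n^2.) *)

theory Submission
  imports Defs
begin

text \<open>The size bound contains log(1/\<open>\<epsilon>'\<close>) only once, outside the power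
  \<open>d - 1\<close> of log S. The ordinary switching lemma with a union bound over the gates
  would require failure probability about \<open>\<epsilon>'\<close> at every level, so that
  log(1/\<open>\<epsilon>'\<close>) would enter the width, and hence the star probability, at each
  of them. Here the gates get trees of depth O(log S) whatever \<open>\<epsilon>'\<close> is; the
  rare long computations are moved into the common tree, and its depth meets
  log(1/\<open>\<epsilon>'\<close>) only once, at the end. Exponential moments are tracked instead
  of tail bounds because they compose. A further restriction answers most queries of the common tree
  for free, which lowers the base of its moment from 4 to 7/4. This gain pays for the trees that the
  next level adds, so the same bound 2 survives any number of levels.\<close>

section \<open>Random restrictions\<close>

text \<open>The expectation of \<open>h\<close> over a random partial assignment of \<open>V\<close> in which every variable is
  independently left free, set to \<open>False\<close>, or set to \<open>True\<close> with the weights given by \<open>u\<close>. Both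
  restrictions and biased total assignments are of this form.\<close>

definition rsum :: "(bool option \<Rightarrow> real) \<Rightarrow> 'v set \<Rightarrow> (('v \<rightharpoonup> bool) \<Rightarrow> real) \<Rightarrow> real" where
  "rsum u V h = (\<Sum>\<rho> | dom \<rho> \<subseteq> V. (\<Prod>v\<in>V. u (\<rho> v)) * h \<rho>)"

lemma finite_partial_maps:
  assumes "finite V"
  shows "finite {\<rho> :: 'v \<rightharpoonup> bool. dom \<rho> \<subseteq> V}"
proof -
  have "{\<rho> :: 'v \<rightharpoonup> bool. dom \<rho> \<subseteq> V} = (\<Union>D\<in>Pow V. {\<rho>. dom \<rho> = D \<and> ran \<rho> \<subseteq> UNIV})"
    by auto
  moreover have "finite {\<rho> :: 'v \<rightharpoonup> bool. dom \<rho> = D \<and> ran \<rho> \<subseteq> UNIV}" if "D \<in> Pow V" for D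
    using that assms by (intro finite_set_of_finite_maps) (auto intro: finite_subset)
  ultimately show ?thesis
    using assms by (metis (no_types, lifting) finite_Pow_iff finite_UN)
qed

lemma rsum_empty [simp]: "rsum u {} h = h Map.empty"
  by (simp add: rsum_def)

lemma rsum_cong:
  assumes "\<And>\<rho>. dom \<rho> \<subseteq> V \<Longrightarrow> h \<rho> = h' \<rho>"
  shows "rsum u V h = rsum u V h'"
  unfolding rsum_def using assms by (intro sum.cong) auto

lemma rsum_mono:
  assumes "\<And>y. 0 \<le> u y" "\<And>\<rho>. dom \<rho> \<subseteq> V \<Longrightarrow> h \<rho> \<le> h' \<rho>"
  shows "rsum u V h \<le> rsum u V h'"
  unfolding rsum_def using assms by (intro sum_mono mult_left_mono prod_nonneg) auto

lemma rsum_nonneg: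
  assumes "\<And>y. 0 \<le> u y" "\<And>\<rho>. dom \<rho> \<subseteq> V \<Longrightarrow> 0 \<le> h \<rho>"
  shows "0 \<le> rsum u V h"
  unfolding rsum_def using assms by (intro sum_nonneg mult_nonneg_nonneg prod_nonneg) auto

lemma rsum_add: "rsum u V (\<lambda>\<rho>. h \<rho> + h' \<rho>) = rsum u V h + rsum u V h'"
  unfolding rsum_def by (simp add: sum.distrib algebra_simps)

lemma rsum_cmult: "rsum u V (\<lambda>\<rho>. c * h \<rho>) = c * rsum u V h"
  unfolding rsum_def by (simp add: sum_distrib_left algebra_simps)

lemma rsum_sum: "rsum u V (\<lambda>\<rho>. \<Sum>i\<in>I. h i \<rho>) = (\<Sum>i\<in>I. rsum u V (h i))"
  unfolding rsum_def sum_distrib_left by (rule sum.swap)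

lemma rsum_insert:
  assumes "finite V" "v \<notin> V"
  shows "rsum u (insert v V) h = u None * rsum u V h
    + u (Some False) * rsum u V (\<lambda>\<rho>. h (\<rho>(v \<mapsto> False)))
    + u (Some True) * rsum u V (\<lambda>\<rho>. h (\<rho>(v \<mapsto> True)))"
proof -
  let ?w = "\<lambda>\<rho>. \<Prod>v\<in>V. u (\<rho> v)"
  have undef: "\<rho> v = None" if "dom \<rho> \<subseteq> V" for \<rho> :: "'a \<rightharpoonup> bool"
    using that assms(2) by blast
  have "rsum u (insert v V) h
      = (\<Sum>(y, \<rho>) \<in> UNIV \<times> {\<rho>. dom \<rho> \<subseteq> V}. u y * (?w \<rho> * h (\<rho>(v := y))))"
    unfolding rsum_def
  proof (rule sum.reindex_bij_witness[where i = "\<lambda>(y, \<rho>). \<rho>(v := y)"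
        and j = "\<lambda>\<rho>. (\<rho> v, \<rho>(v := None))"], goal_cases)
    case (5 \<rho>)
    have "(\<Prod>w\<in>V. u ((\<rho>(v := None)) w)) = ?w \<rho>"
      using assms(2) by (intro prod.cong) auto
    then show ?case
      using assms by (simp add: mult.assoc)
  qed (use undef in \<open>auto simp: fun_eq_iff domIff subset_iff split: if_splits\<close>)
  also have "\<dots> = (\<Sum>y\<in>UNIV. u y * rsum u V (\<lambda>\<rho>. h (\<rho>(v := y))))"
    by (simp add: sum.cartesian_product[symmetric] rsum_def sum_distrib_left)
  also have "\<dots> = u None * rsum u V (\<lambda>\<rho>. h (\<rho>(v := None)))
    + u (Some False) * rsum u V (\<lambda>\<rho>. h (\<rho>(v \<mapsto> False)))
    + u (Some True) * rsum u V (\<lambda>\<rho>. h (\<rho>(v \<mapsto> True)))"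
    by (simp add: UNIV_option_conv UNIV_bool)
  also have "rsum u V (\<lambda>\<rho>. h (\<rho>(v := None))) = rsum u V h"
    by (intro rsum_cong arg_cong[of _ _ h]) (auto simp: undef fun_eq_iff)
  finally show ?thesis .
qed

lemma rsum_const:
  assumes "finite V" "u None + u (Some False) + u (Some True) = 1"
  shows "rsum u V (\<lambda>_. c) = c"
  using assms(1)
proof induction
  case (insert v V)
  have "rsum u (insert v V) (\<lambda>_. c) = (u None + u (Some False) + u (Some True)) * c"
    using insert by (simp add: rsum_insert algebra_simps)
  then show ?case
    using assms(2) by simp
qed simp

lemma rsum_union:
  assumes "finite U" "finite V" "U \<inter> V = {}"
  shows "rsum u (U \<union> V) h = rsum u U (\<lambda>\<sigma>. rsum u V (\<lambda>\<rho>. h (\<rho> ++ \<sigma>)))"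
  using assms(1,3)
proof (induction U arbitrary: h)
  case empty
  then show ?case by simp
next
  case (insert x U)
  then have "x \<notin> U \<union> V" "finite (U \<union> V)" "U \<inter> V = {}"
    using assms(2) by auto
  then show ?case
    using insert by (simp add: rsum_insert map_add_upd)
qed

text \<open>The law of one variable when those left free by \<open>u\<close> are resampled from \<open>u'\<close>.\<close>

definition comp_weight :: "(bool option \<Rightarrow> real) \<Rightarrow> (bool option \<Rightarrow> real) \<Rightarrow> bool option \<Rightarrow> real" where
  "comp_weight u u' y = u None * u' y + (if y = None then 0 else u y)"

lemma comp_weight_None: "comp_weight u u' None = u None * u' None"
  and comp_weight_Some: "comp_weight u u' (Some b) = u None * u' (Some b) + u (Some b)"
  by (simp_all add: comp_weight_def)

lemma rsum_comp:
  assumes "finite V" "u' None + u' (Some False) + u' (Some True) = 1"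
  shows "rsum u V (\<lambda>\<rho>. rsum u' (V - dom \<rho>) (\<lambda>\<sigma>. h (\<sigma> ++ \<rho>))) = rsum (comp_weight u u') V h"
  using assms(1)
proof (induction V arbitrary: h)
  case empty
  then show ?case by simp
next
  case (insert v V)
  let ?H = "\<lambda>h \<rho>. rsum u' (V - dom \<rho>) (\<lambda>\<sigma>. h (\<sigma> ++ \<rho>))"
  let ?G = "\<lambda>\<rho>. rsum u' (insert v V - dom \<rho>) (\<lambda>\<sigma>. h (\<sigma> ++ \<rho>))"
  have G: "rsum u V ?G = u' None * rsum u V (?H h)
      + u' (Some False) * rsum u V (?H (\<lambda>\<rho>. h (\<rho>(v \<mapsto> False))))
      + u' (Some True) * rsum u V (?H (\<lambda>\<rho>. h (\<rho>(v \<mapsto> True))))"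
  proof -
    have "?G \<rho> = u' None * ?H h \<rho> + u' (Some False) * ?H (\<lambda>\<rho>. h (\<rho>(v \<mapsto> False))) \<rho>
      + u' (Some True) * ?H (\<lambda>\<rho>. h (\<rho>(v \<mapsto> True))) \<rho>" if "dom \<rho> \<subseteq> V" for \<rho>
    proof -
      have v: "v \<notin> dom \<rho>" using that insert by auto
      then have "insert v V - dom \<rho> = insert v (V - dom \<rho>)" by auto
      moreover have "(\<sigma>(v \<mapsto> b)) ++ \<rho> = (\<sigma> ++ \<rho>)(v \<mapsto> b)" for \<sigma> b
        using v by (rule map_add_upd_left)
      ultimately show ?thesis
        using insert by (simp add: rsum_insert)
    qed
    then have "rsum u V ?G = rsum u V (\<lambda>\<rho>. u' None * ?H h \<rho> + u' (Some False) * ?H (\<lambda>\<rho>. h (\<rho>(v \<mapsto> False))) \<rho>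
      + u' (Some True) * ?H (\<lambda>\<rho>. h (\<rho>(v \<mapsto> True))) \<rho>)"
      by (rule rsum_cong)
    then show ?thesis
      by (simp add: rsum_add rsum_cmult)
  qed
  have U: "rsum u V (\<lambda>\<rho>. ?G (\<rho>(v \<mapsto> b))) = rsum u V (?H (\<lambda>\<rho>. h (\<rho>(v \<mapsto> b))))" for b
  proof -
    have "insert v V - dom (\<rho>(v \<mapsto> b)) = V - dom \<rho>" for \<rho> :: "'a \<rightharpoonup> bool"
      using insert by auto
    then show ?thesis
      by (simp add: map_add_upd)
  qed
  have "rsum u (insert v V) ?G = u None * rsum u V ?G
    + u (Some False) * rsum u V (?H (\<lambda>\<rho>. h (\<rho>(v \<mapsto> False))))
    + u (Some True) * rsum u V (?H (\<lambda>\<rho>. h (\<rho>(v \<mapsto> True))))"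
    using rsum_insert[OF insert.hyps, of u ?G] by (simp only: U)
  then show ?case
    unfolding G insert.IH[of h] insert.IH[of "\<lambda>\<rho>. h (\<rho>(v \<mapsto> False))"]
      insert.IH[of "\<lambda>\<rho>. h (\<rho>(v \<mapsto> True))"] rsum_insert[OF insert.hyps]
    by (simp add: comp_weight_None comp_weight_Some algebra_simps)
qed

section \<open>Uniform restrictions, biased assignments and their composition\<close>

definition restr_weight :: "real \<Rightarrow> bool option \<Rightarrow> real" where
  "restr_weight p y = (if y = None then p else (1 - p) / 2)"

definition bias_weight :: "real \<Rightarrow> bool option \<Rightarrow> real" where
  "bias_weight \<beta> y = (case y of None \<Rightarrow> 0 | Some b \<Rightarrow> if b then 1/2 - \<beta> else 1/2 + \<beta>)"

lemma comp_restr_restr: "comp_weight (restr_weight p) (restr_weight p') = restr_weight (p * p')"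
  by (auto simp: fun_eq_iff comp_weight_def restr_weight_def field_simps)

text \<open>The variables fixed by the restriction are unbiased, so only the fraction
  \<open>p\<close> left free contributes to the bias. Hence total bias \<alpha> calls for \<beta> =
  \<alpha> / p on the stars.\<close>

lemma comp_restr_bias: "comp_weight (restr_weight p) (bias_weight \<beta>) = bias_weight (p * \<beta>)"
  by (auto simp: fun_eq_iff comp_weight_def restr_weight_def bias_weight_def field_simps split: option.split)

lemma restr_weight_nonneg: "0 \<le> p \<Longrightarrow> p \<le> 1 \<Longrightarrow> 0 \<le> restr_weight p y"
  by (simp add: restr_weight_def)

lemma bias_weight_nonneg: "0 \<le> \<beta> \<Longrightarrow> \<beta> \<le> 1/2 \<Longrightarrow> 0 \<le> bias_weight \<beta> y"
  by (simp add: bias_weight_def split: option.split)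

lemma restr_weight_total:
  "restr_weight p None + restr_weight p (Some False) + restr_weight p (Some True) = 1"
  by (simp add: restr_weight_def field_simps)

lemma bias_weight_total:
  "bias_weight \<beta> None + bias_weight \<beta> (Some False) + bias_weight \<beta> (Some True) = 1"
  by (simp add: bias_weight_def)

text \<open>A free variable has weight 0 under \<open>bias_weight\<close>, so partial assignments do
  not contribute, although \<open>rsum\<close> runs over them.\<close>

lemma rsum_bias_cong:
  assumes "finite V" "\<And>\<sigma>. dom \<sigma> = V \<Longrightarrow> h \<sigma> = h' \<sigma>"
  shows "rsum (bias_weight \<beta>) V h = rsum (bias_weight \<beta>) V h'"
  unfolding rsum_def
proof (intro sum.cong refl)
  fix \<sigma> :: "'a \<rightharpoonup> bool" assume "\<sigma> \<in> {\<rho>. dom \<rho> \<subseteq> V}"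
  then have sub: "dom \<sigma> \<subseteq> V" by simp
  show "(\<Prod>v\<in>V. bias_weight \<beta> (\<sigma> v)) * h \<sigma> = (\<Prod>v\<in>V. bias_weight \<beta> (\<sigma> v)) * h' \<sigma>"
  proof (cases "dom \<sigma> = V")
    case False
    then obtain v where "v \<in> V" "\<sigma> v = None"
      using sub by blast
    then have "(\<Prod>v\<in>V. bias_weight \<beta> (\<sigma> v)) = 0"
      using assms(1) by (intro prod_zero) (auto simp: bias_weight_def intro!: bexI[of _ v])
    then show ?thesis by simp
  qed (simp add: assms(2))
qed

section \<open>Decision trees\<close>

text \<open>A tree of depth \<open>t\<close> extends \<open>\<rho>\<close> by querying variables so that \<open>P\<close> holds at every leaf. For
  \<open>P = forced N f\<close> this is a decision tree for the restriction of \<open>f\<close> by \<open>\<rho>\<close>; for other \<open>P\<close>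
  it is a common partial decision tree, as in the multi-switching lemma.\<close>

fun query_tree :: "'v set \<Rightarrow> nat \<Rightarrow> (('v \<rightharpoonup> bool) \<Rightarrow> bool) \<Rightarrow> ('v \<rightharpoonup> bool) \<Rightarrow> bool" where
  "query_tree N 0 P \<rho> \<longleftrightarrow> P \<rho>"
| "query_tree N (Suc t) P \<rho> \<longleftrightarrow>
     P \<rho> \<or> (\<exists>v \<in> N - dom \<rho>. \<forall>b. query_tree N t P (\<rho>(v \<mapsto> b)))"

definition query_depth :: "'v set \<Rightarrow> (('v \<rightharpoonup> bool) \<Rightarrow> bool) \<Rightarrow> ('v \<rightharpoonup> bool) \<Rightarrow> nat" where
  "query_depth N P \<rho> = (LEAST t. query_tree N t P \<rho>)"

text \<open>Only total extensions are tested: \<open>f\<close> may be arbitrary on partial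
  assignments, and it can be exchanged for any function that agrees with it on the total extensions
  of \<rho>.\<close>

definition forced :: "'v set \<Rightarrow> (('v \<rightharpoonup> bool) \<Rightarrow> bool) \<Rightarrow> ('v \<rightharpoonup> bool) \<Rightarrow> bool" where
  "forced N f \<rho> \<longleftrightarrow> (\<exists>c. \<forall>\<sigma>. \<rho> \<subseteq>\<^sub>m \<sigma> \<longrightarrow> dom \<sigma> = N \<longrightarrow> f \<sigma> = c)"

lemma query_tree_leaf: "P \<rho> \<Longrightarrow> query_tree N t P \<rho>"
  by (cases t) auto

text \<open>All leaves extend \<rho>, so P' has to follow from P only there. Later this lets a gate
  be replaced by a DNF that is correct merely under the current restriction.\<close>

lemma query_tree_mono:
  assumes "query_tree N t P \<rho>" "t \<le> t'" 
    and "\<And>\<rho>'. \<rho> \<subseteq>\<^sub>m \<rho>' \<Longrightarrow> P \<rho>' \<Longrightarrow> P' \<rho>'"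
  shows "query_tree N t' P' \<rho>"
  using assms
proof (induction t arbitrary: t' \<rho>)
  case 0
  then show ?case by (auto intro!: query_tree_leaf)
next
  case (Suc t)
  then obtain s where t': "t' = Suc s" "t \<le> s"
    by (cases t') auto
  show ?case
  proof (cases "P \<rho>")
    case True
    then show ?thesis using Suc.prems(3) by (auto intro!: query_tree_leaf)
  next
    case False
    then obtain v where v: "v \<in> N - dom \<rho>" "\<And>b. query_tree N t P (\<rho>(v \<mapsto> b))"
      using Suc.prems(1) by auto
    have "query_tree N s P' (\<rho>(v \<mapsto> b))" for b
    proof (rule Suc.IH[OF v(2) t'(2)])
      fix \<rho>' assume "\<rho>(v \<mapsto> b) \<subseteq>\<^sub>m \<rho>'" "P \<rho>'"
      moreover have "\<rho> \<subseteq>\<^sub>m \<rho>(v \<mapsto> b)"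
        using v(1) by (auto simp: map_le_def)
      ultimately show "P' \<rho>'"
        using Suc.prems(3) map_le_trans by blast
    qed
    then show ?thesis
      using v(1) t'(1) by auto
  qed
qed

lemma query_tree_weaken: "query_tree N t P \<rho> \<Longrightarrow> t \<le> t' \<Longrightarrow> query_tree N t' P \<rho>"
  by (rule query_tree_mono)

lemma query_tree_block:
  assumes "finite J" "J \<subseteq> N - dom \<rho>"
    and "\<And>\<tau>. dom \<tau> = J \<Longrightarrow> query_tree N t P (\<rho> ++ \<tau>)"
  shows "query_tree N (t + card J) P \<rho>"
  using assms
proof (induction J arbitrary: \<rho>)
  case empty
  then show ?case by simp
next
  case (insert v J)
  have "query_tree N (t + card J) P (\<rho>(v \<mapsto> b))" for b
  proof (rule insert.IH)
    show "J \<subseteq> N - dom (\<rho>(v \<mapsto> b))"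
      using insert by auto
    fix \<tau> :: "'a \<rightharpoonup> bool" assume "dom \<tau> = J"
    then have "dom (\<tau>(v \<mapsto> b)) = insert v J"
      by (simp only: dom_fun_upd) simp
    then have "query_tree N t P (\<rho> ++ \<tau>(v \<mapsto> b))"
      by (rule insert.prems)
    moreover have "\<rho>(v \<mapsto> b) ++ \<tau> = \<rho> ++ \<tau>(v \<mapsto> b)"
      using \<open>dom \<tau> = J\<close> insert.hyps(2) by (simp add: map_add_upd_left)
    ultimately show "query_tree N t P (\<rho>(v \<mapsto> b) ++ \<tau>)"
      by simp
  qed
  moreover have "v \<in> N - dom \<rho>"
    using insert.prems(1) by simp
  ultimately have "query_tree N (Suc (t + card J)) P \<rho>"
    unfolding query_tree.simps by blast
  then show ?case
    using insert.hyps by simp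
qed

lemma query_depth_le: "query_tree N t P \<rho> \<Longrightarrow> query_depth N P \<rho> \<le> t"
  unfolding query_depth_def by (rule Least_le)

text \<open>Querying every remaining variable always works if P holds at total assignments. This
  makes the \<open>LEAST\<close> in \<open>query_depth\<close> meaningful and is the reason why that
  assumption on P accompanies most lemmas on depth.\<close>

lemma query_tree_exists:
  assumes "finite N" "dom \<rho> \<subseteq> N" "\<And>\<sigma>. dom \<sigma> = N \<Longrightarrow> P \<sigma>"
  shows "query_tree N (card (N - dom \<rho>)) P \<rho>"
proof -
  have tot: "dom (\<rho> ++ \<tau>) = N" if "dom \<tau> = N - dom \<rho>" for \<tau>
    unfolding dom_map_add that using assms(2) by blast
  have "query_tree N 0 P (\<rho> ++ \<tau>)" if "dom \<tau> = N - dom \<rho>" for \<tau>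
    using assms(3)[OF tot[OF that]] by simp
  from query_tree_block[OF _ order_refl this]
  have "query_tree N (0 + card (N - dom \<rho>)) P \<rho>"
    using assms(1) by blast
  then show ?thesis by simp
qed

lemma query_tree_depth:
  assumes "finite N" "dom \<rho> \<subseteq> N" "\<And>\<sigma>. dom \<sigma> = N \<Longrightarrow> P \<sigma>"
  shows "query_tree N (query_depth N P \<rho>) P \<rho>"
  unfolding query_depth_def using query_tree_exists[of N \<rho> P, OF assms] by (rule LeastI)

lemma query_depth_antimono:
  assumes "finite N" "dom \<rho> \<subseteq> N" "\<And>\<sigma>. dom \<sigma> = N \<Longrightarrow> P \<sigma>"
    and "\<And>\<rho>'. \<rho> \<subseteq>\<^sub>m \<rho>' \<Longrightarrow> P \<rho>' \<Longrightarrow> P' \<rho>'"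
  shows "query_depth N P' \<rho> \<le> query_depth N P \<rho>"
proof (rule query_depth_le, rule query_tree_mono[OF _ le_refl])
  show "query_tree N (query_depth N P \<rho>) P \<rho>"
    using assms(1-3) by (rule query_tree_depth)
qed (rule assms(4))

lemma forced_total: "dom \<sigma> = N \<Longrightarrow> forced N f \<sigma>"
proof -
  assume "dom \<sigma> = N"
  then have "\<sigma>' = \<sigma>" if "\<sigma> \<subseteq>\<^sub>m \<sigma>'" "dom \<sigma>' = N" for \<sigma>'
    using that by (intro map_le_antisym) (auto simp: map_le_def)
  then show ?thesis
    unfolding forced_def by blast
qed

lemma ex_map_dom: "\<exists>\<tau> :: 'v \<rightharpoonup> bool. dom \<tau> = J"
  by (rule exI[of _ "\<lambda>v. if v \<in> J then Some True else None"]) (auto split: if_splits)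

lemma finite_maps_dom:
  assumes "finite J"
  shows "finite {\<tau> :: 'v \<rightharpoonup> bool. dom \<tau> = J}"
  using finite_partial_maps[OF assms] by (rule rev_finite_subset) auto

text \<open>A tree can query J first and continue optimally, at the cost of the worst answer. The
  maximum over the answers is replaced by their sum because sums commute with \<open>rsum\<close>;
  the 2 ^ card J summands become the sum over \<pi> in \<open>path_weight\<close>.\<close>

lemma query_depth_block:
  fixes z :: real
  assumes "finite N" "dom \<rho> \<subseteq> N" "\<And>\<sigma>. dom \<sigma> = N \<Longrightarrow> P \<sigma>" "1 \<le> z" "J \<subseteq> N - dom \<rho>"
  shows "z ^ query_depth N P \<rho> \<le> (\<Sum>\<tau> | dom \<tau> = J. z ^ card J * z ^ query_depth N P (\<rho> ++ \<tau>))"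
proof -
  have fJ: "finite J"
    using assms by (meson finite_Diff finite_subset)
  have fA: "finite {\<tau> :: 'a \<rightharpoonup> bool. dom \<tau> = J}"
    using fJ by (rule finite_maps_dom)
  let ?d = "\<lambda>\<tau>. query_depth N P (\<rho> ++ \<tau>)"
  have ne: "{\<tau> :: 'a \<rightharpoonup> bool. dom \<tau> = J} \<noteq> {}"
    using ex_map_dom[of J] by simp
  define m where "m = Max (?d ` {\<tau>. dom \<tau> = J})"
  have "m \<in> ?d ` {\<tau>. dom \<tau> = J}"
    unfolding m_def using fA ne by (intro Max_in) auto
  then obtain \<tau> where \<tau>: "dom \<tau> = J" "m = ?d \<tau>"
    by blast
  have "query_tree N m P (\<rho> ++ \<tau>')" if "dom \<tau>' = J" for \<tau>'
  proof -
    have "query_tree N (?d \<tau>') P (\<rho> ++ \<tau>')"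
      using assms that by (intro query_tree_depth) auto
    moreover have "?d \<tau>' \<le> m"
      unfolding m_def using fA that by (intro Max_ge) auto
    ultimately show ?thesis by (rule query_tree_weaken)
  qed
  then have "query_depth N P \<rho> \<le> m + card J"
    using fJ assms by (intro query_depth_le query_tree_block) auto
  then have "z ^ query_depth N P \<rho> \<le> z ^ card J * z ^ ?d \<tau>"
    using \<tau> assms(4) by (simp add: power_increasing power_add[symmetric] add.commute)
  also have "\<dots> \<le> (\<Sum>\<tau> | dom \<tau> = J. z ^ card J * z ^ ?d \<tau>)"
    using \<tau> fA assms(4) by (intro member_le_sum) auto
  finally show ?thesis .
qed

section \<open>The multi-switching lemma\<close>

definition conflict :: "('v \<rightharpoonup> bool) \<Rightarrow> ('v \<rightharpoonup> bool) \<Rightarrow> bool" where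
  "conflict T \<rho> \<longleftrightarrow> (\<exists>v \<in> dom T \<inter> dom \<rho>. T v \<noteq> \<rho> v)"

definition dnf :: "('v \<rightharpoonup> bool) list \<Rightarrow> ('v \<rightharpoonup> bool) \<Rightarrow> bool" where
  "dnf F \<sigma> \<longleftrightarrow> (\<exists>T \<in> set F. T \<subseteq>\<^sub>m \<sigma>)"

text \<open>Sums over the root-to-leaf paths \<open>\<tau>\<close>, cut off once \<open>s\<close> variables are queried, of the canonical
  decision tree of \<open>F\<close> under \<open>\<rho>\<close>. A second assignment \<open>\<rho>'\<close> receives all possible answers \<open>\<pi>\<close> to
  the same queries: the path is long for \<open>F\<close> along \<open>\<tau>\<close>, whereas the common tree must be continued
  for every answer.\<close>

fun path_weight :: "real \<Rightarrow> (('v \<rightharpoonup> bool) \<Rightarrow> real) \<Rightarrow> ('v \<rightharpoonup> bool) list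
    \<Rightarrow> ('v \<rightharpoonup> bool) \<Rightarrow> ('v \<rightharpoonup> bool) \<Rightarrow> nat \<Rightarrow> real" where
  "path_weight z A F \<rho> \<rho>' 0 = A \<rho>'"
| "path_weight z A [] \<rho> \<rho>' (Suc s) = 0"
| "path_weight z A (T # F) \<rho> \<rho>' (Suc s) =
     (if conflict T \<rho> then path_weight z A F \<rho> \<rho>' (Suc s)
      else if dom T \<subseteq> dom \<rho> then 0
      else let J = dom T - dom \<rho> in
        \<Sum>\<tau> | dom \<tau> = J. \<Sum>\<pi> | dom \<pi> = J.
          z ^ card J * path_weight z A F (\<rho> ++ \<tau>) (\<rho>' ++ \<pi>) (Suc s - card J))"

lemma path_weight_nonneg:
  assumes "0 \<le> z" "\<And>\<rho>. 0 \<le> A \<rho>"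
  shows "0 \<le> path_weight z A F \<rho> \<rho>' s"
proof (induction F arbitrary: \<rho> \<rho>' s)
  case Nil
  then show ?case by (cases s) (simp_all add: assms)
next
  case (Cons T F)
  then show ?case
    by (cases s) (auto simp: Let_def assms intro!: sum_nonneg mult_nonneg_nonneg)
qed

lemma conflict_map_le: "conflict T \<rho> \<Longrightarrow> \<rho> \<subseteq>\<^sub>m \<rho>' \<Longrightarrow> conflict T \<rho>'"
  unfolding conflict_def map_le_def by (metis IntE IntI domD domI)

lemma dnf_Cons_conflict:
  assumes "conflict T \<rho>" "\<rho> \<subseteq>\<^sub>m \<sigma>"
  shows "dnf (T # F) \<sigma> = dnf F \<sigma>"
proof -
  have "\<not> T \<subseteq>\<^sub>m \<sigma>"
    using assms unfolding conflict_def map_le_def by (metis IntE)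
  then show ?thesis by (simp add: dnf_def)
qed

lemma forced_dnf_sat:
  assumes "T \<in> set F" "T \<subseteq>\<^sub>m \<rho>"
  shows "forced N (dnf F) \<rho>"
  using assms unfolding forced_def dnf_def by (meson map_le_trans)

lemma no_conflict_sat: "\<not> conflict T \<rho> \<Longrightarrow> dom T \<subseteq> dom \<rho> \<Longrightarrow> T \<subseteq>\<^sub>m \<rho>"
  unfolding conflict_def map_le_def by blast

lemma forced_cong_map_le:
  assumes "forced N f \<rho>" "\<And>\<sigma>. \<rho> \<subseteq>\<^sub>m \<sigma> \<Longrightarrow> dom \<sigma> = N \<Longrightarrow> f \<sigma> = g \<sigma>"
  shows "forced N g \<rho>"
  using assms unfolding forced_def by metis

lemma query_tree_dnf_conflict:
  assumes "conflict T \<rho>" "query_tree N t (forced N (dnf F)) \<rho>"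
  shows "query_tree N t (forced N (dnf (T # F))) \<rho>"
  using assms(2) le_refl
proof (rule query_tree_mono)
  fix \<rho>' assume "\<rho> \<subseteq>\<^sub>m \<rho>'" "forced N (dnf F) \<rho>'"
  then show "forced N (dnf (T # F)) \<rho>'"
    using dnf_Cons_conflict[OF assms(1)] map_le_trans[of \<rho> \<rho>']
    by (auto intro: forced_cong_map_le)
qed

lemma query_tree_dnf_sat:
  assumes "\<not> conflict T \<rho>" "dom T \<subseteq> dom \<rho>"
  shows "query_tree N t (forced N (dnf (T # F))) \<rho>"
proof (rule query_tree_leaf, rule forced_dnf_sat)
  show "T \<subseteq>\<^sub>m \<rho>"
    using assms by (rule no_conflict_sat)
qed simp

text \<open>If F has no tree of depth s - 1 under \<rho>, its canonical tree has a path of length at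
  least s, and the nonnegative sum over \<tau> contains that path. The common tree asks the same
  queries at \<rho>', where the answers \<pi> are unrelated to \<tau>. Truncated subtraction is
  intended: a path that overshoots s has done its work.\<close>

lemma path_weight_ge:
  fixes z :: real
  assumes "finite N" "\<And>\<sigma>. dom \<sigma> = N \<Longrightarrow> P \<sigma>" "1 \<le> z"
    and "\<And>T. T \<in> set F \<Longrightarrow> dom T \<subseteq> N" "dom \<rho> \<subseteq> N" "dom \<rho>' = dom \<rho>"
    and "s = 0 \<or> \<not> query_tree N (s - 1) (forced N (dnf F)) \<rho>"
  shows "z ^ query_depth N P \<rho>' \<le> path_weight z (\<lambda>\<rho>. z ^ query_depth N P \<rho>) F \<rho> \<rho>' s"
  using assms(4-)
proof (induction F arbitrary: \<rho> \<rho>' s)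
  case Nil
  have "forced N (dnf []) \<rho>" by (auto simp: forced_def dnf_def)
  then have "s = 0" using Nil query_tree_leaf[of "forced N (dnf [])" \<rho> N "s - 1"] by auto
  then show ?case by simp
next
  case (Cons T F)
  let ?A = "\<lambda>\<rho>. z ^ query_depth N P \<rho>"
  show ?case
  proof (cases s)
    case 0
    then show ?thesis by simp
  next
    case (Suc r)
    then have nq: "\<not> query_tree N r (forced N (dnf (T # F))) \<rho>"
      using Cons.prems by simp
    show ?thesis
    proof (cases "conflict T \<rho>")
      case True
      have "\<not> query_tree N r (forced N (dnf F)) \<rho>"
      proof
        assume "query_tree N r (forced N (dnf F)) \<rho>"
        with True have "query_tree N r (forced N (dnf (T # F))) \<rho>"
          by (rule query_tree_dnf_conflict)
        then show False using nq by blast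
      qed
      then have "?A \<rho>' \<le> path_weight z ?A F \<rho> \<rho>' s"
        using Suc Cons.prems by (intro Cons.IH) auto
      then show ?thesis
        using True Suc by simp
    next
      case False
      have nsub: "\<not> dom T \<subseteq> dom \<rho>"
      proof
        assume "dom T \<subseteq> dom \<rho>"
        with False have "query_tree N r (forced N (dnf (T # F))) \<rho>"
          by (rule query_tree_dnf_sat)
        then show False using nq by blast
      qed
      define J where "J = dom T - dom \<rho>"
      have J: "J \<subseteq> N - dom \<rho>" "finite J"
        using Cons.prems(1)[of T] assms(1) unfolding J_def
        by (auto intro: finite_subset)
      have fA: "finite {\<tau> :: 'a \<rightharpoonup> bool. dom \<tau> = J}"
        using J(2) by (rule finite_maps_dom)
      have "\<exists>\<tau>. dom \<tau> = J \<and>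
          (s - card J = 0 \<or> \<not> query_tree N (s - card J - 1) (forced N (dnf F)) (\<rho> ++ \<tau>))"
      proof (rule ccontr)
        assume contr: "\<not> ?thesis"
        have c: "s - card J \<noteq> 0" "query_tree N (s - card J - 1) (forced N (dnf F)) (\<rho> ++ \<tau>)"
          if "dom \<tau> = J" for \<tau>
          using spec[OF contr[unfolded not_ex], of \<tau>] that by simp_all
        have pos: "s - card J > 0"
        proof -
          obtain \<tau> :: "'a \<rightharpoonup> bool" where "dom \<tau> = J"
            using ex_map_dom[of J] by (elim exE)
          then show ?thesis using c(1)[of \<tau>] by simp
        qed
        have "query_tree N (s - card J - 1) (forced N (dnf (T # F))) (\<rho> ++ \<tau>)" if \<tau>: "dom \<tau> = J" for \<tau>
        proof (cases "conflict T (\<rho> ++ \<tau>)")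
          case True
          moreover have "query_tree N (s - card J - 1) (forced N (dnf F)) (\<rho> ++ \<tau>)"
            using \<tau> by (rule c(2))
          ultimately show ?thesis
            by (rule query_tree_dnf_conflict)
        next
          case False
          moreover have "dom T \<subseteq> dom (\<rho> ++ \<tau>)"
            unfolding dom_map_add \<tau> J_def by blast
          ultimately show ?thesis
            by (rule query_tree_dnf_sat)
        qed
        then have "query_tree N (s - card J - 1 + card J) (forced N (dnf (T # F))) \<rho>"
          using J(1,2) by (intro query_tree_block)
        moreover have "s - card J - 1 + card J = r"
          using pos Suc by simp
        ultimately show False using nq by simp
      qed
      then obtain \<tau> where \<tau>: "dom \<tau> = J"
        "s - card J = 0 \<or> \<not> query_tree N (s - card J - 1) (forced N (dnf F)) (\<rho> ++ \<tau>)"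
        by (elim exE conjE)
      let ?pw = "\<lambda>\<tau> \<pi>. path_weight z ?A F (\<rho> ++ \<tau>) (\<rho>' ++ \<pi>) (s - card J)"
      have nn: "0 \<le> z ^ card J * ?pw \<tau> \<pi>" for \<tau> \<pi>
        using assms(3) by (intro mult_nonneg_nonneg path_weight_nonneg) auto
      have "?A \<rho>' \<le> (\<Sum>\<pi> | dom \<pi> = J. z ^ card J * ?A (\<rho>' ++ \<pi>))"
        using Cons.prems(2,3) J(1) by (intro query_depth_block assms(1-3)) simp_all
      also have "\<dots> \<le> (\<Sum>\<pi> | dom \<pi> = J. z ^ card J * ?pw \<tau> \<pi>)"
      proof (intro sum_mono mult_left_mono)
        fix \<pi> :: "'a \<rightharpoonup> bool" assume \<pi>: "\<pi> \<in> {\<pi>. dom \<pi> = J}"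
        show "?A (\<rho>' ++ \<pi>) \<le> ?pw \<tau> \<pi>"
        proof (rule Cons.IH)
          show "dom (\<rho> ++ \<tau>) \<subseteq> N"
            using Cons.prems(2) J(1) \<tau>(1) by auto
          show "dom (\<rho>' ++ \<pi>) = dom (\<rho> ++ \<tau>)"
            using Cons.prems(3) \<pi> \<tau>(1) by simp
        qed (use Cons.prems(1) \<tau>(2) in simp_all)
      qed (use assms(3) in simp)
      also have "\<dots> \<le> (\<Sum>\<tau> | dom \<tau> = J. \<Sum>\<pi> | dom \<pi> = J. z ^ card J * ?pw \<tau> \<pi>)"
      proof (rule member_le_sum)
        show "\<tau> \<in> {\<tau>. dom \<tau> = J}"
          using \<tau>(1) by simp
      qed (intro sum_nonneg nn fA)+
      also have "\<dots> = path_weight z ?A (T # F) \<rho> \<rho>' s"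
        by (simp only: Suc path_weight.simps False nsub if_False Let_def J_def[symmetric])
      finally show ?thesis .
    qed
  qed
qed

text \<open>A restriction of U compatible with T is determined by the set J that it leaves free: on
  \<open>U - J\<close> it must copy T.\<close>

lemma rsum_matching:
  assumes "finite U" "U \<subseteq> dom T"
  shows "rsum (restr_weight p) U (\<lambda>\<sigma>. of_bool (\<not> conflict T \<sigma>) * g \<sigma>)
    = (\<Sum>J\<in>Pow U. p ^ card J * ((1 - p) / 2) ^ card (U - J) * g (T |` (U - J)))"
proof -
  let ?w = "\<lambda>\<sigma>. \<Prod>v\<in>U. restr_weight p (\<sigma> v)"
  have w: "?w (T |` (U - J)) = p ^ card J * ((1 - p) / 2) ^ card (U - J)" if "J \<subseteq> U" for J
  proof -
    have "?w (T |` (U - J)) = (\<Prod>v\<in>U. if v \<in> J then p else (1 - p) / 2)"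
      using that assms(2) by (intro prod.cong) (auto simp: restr_weight_def restrict_map_def)
    also have "\<dots> = p ^ card J * ((1 - p) / 2) ^ card (U - J)"
      using assms(1) that by (simp add: prod.If_cases Int_absorb1 Diff_eq)
    finally show ?thesis .
  qed
  have "rsum (restr_weight p) U (\<lambda>\<sigma>. of_bool (\<not> conflict T \<sigma>) * g \<sigma>)
      = (\<Sum>\<sigma> | dom \<sigma> \<subseteq> U \<and> \<not> conflict T \<sigma>. ?w \<sigma> * g \<sigma>)"
    unfolding rsum_def using finite_partial_maps[OF assms(1)]
    by (intro sum.mono_neutral_cong_right) auto
  also have "\<dots> = (\<Sum>J\<in>Pow U. ?w (T |` (U - J)) * g (T |` (U - J)))"
  proof (rule sum.reindex_bij_witness[where i = "\<lambda>J. T |` (U - J)" and j = "\<lambda>\<sigma>. U - dom \<sigma>"])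
    fix \<sigma> assume \<sigma>: "\<sigma> \<in> {\<sigma>. dom \<sigma> \<subseteq> U \<and> \<not> conflict T \<sigma>}"
    then have d: "U - (U - dom \<sigma>) = dom \<sigma>" by auto
    have "T |` dom \<sigma> = \<sigma>"
    proof
      fix v
      show "(T |` dom \<sigma>) v = \<sigma> v"
      proof (cases "v \<in> dom \<sigma>")
        case True
        then have "v \<in> dom T \<inter> dom \<sigma>" using \<sigma> assms(2) by blast
        then have "T v = \<sigma> v" using \<sigma> unfolding conflict_def by blast
        then show ?thesis using True by simp
      qed (simp add: restrict_map_def domIff)
    qed
    then show "T |` (U - (U - dom \<sigma>)) = \<sigma>"
      "?w (T |` (U - (U - dom \<sigma>))) * g (T |` (U - (U - dom \<sigma>))) = ?w \<sigma> * g \<sigma>"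
      by (simp_all only: d)
    show "U - dom \<sigma> \<in> Pow U" by auto
  next
    fix J assume "J \<in> Pow U"
    then show "U - dom (T |` (U - J)) = J"
      using assms(2) by auto
    show "T |` (U - J) \<in> {\<sigma>. dom \<sigma> \<subseteq> U \<and> \<not> conflict T \<sigma>}"
      by (auto simp: conflict_def restrict_map_def split: if_splits)
  qed
  also have "\<dots> = (\<Sum>J\<in>Pow U. p ^ card J * ((1 - p) / 2) ^ card (U - J) * g (T |` (U - J)))"
    using w by (intro sum.cong) auto
  finally show ?thesis .
qed

lemma sum_Pow_power:
  fixes y :: real
  assumes "finite U"
  shows "(\<Sum>J\<in>Pow U. y ^ card J) = (1 + y) ^ card U"
proof -
  have "(\<Prod>x\<in>U. y + 1) = (\<Sum>J\<in>Pow U. (\<Prod>x\<in>J. y) * (\<Prod>x\<in>U-J. 1))"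
    by (rule prod_add[OF assms])
  then show ?thesis by (simp add: add.commute)
qed

lemma card_maps_dom:
  assumes "finite J"
  shows "card {\<tau> :: 'v \<rightharpoonup> bool. dom \<tau> = J} = 2 ^ card J"
proof -
  have "bij_betw (\<lambda>\<tau> :: 'v \<rightharpoonup> bool. {v. \<tau> v = Some True}) {\<tau>. dom \<tau> = J} (Pow J)"
  proof (rule bij_betwI[where g = "\<lambda>S v. if v \<in> J then Some (v \<in> S) else None"])
    show "(\<lambda>v. if v \<in> J then Some (v \<in> {v. \<tau> v = Some True}) else None) = \<tau>"
      if "\<tau> \<in> {\<tau>. dom \<tau> = J}" for \<tau>
    proof
      fix v show "(if v \<in> J then Some (v \<in> {v. \<tau> v = Some True}) else None) = \<tau> v"
        using that by (cases "\<tau> v") (auto simp: domIff)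
    qed
  qed (auto split: if_splits)
  then show ?thesis
    using assms by (simp add: bij_betw_same_card card_Pow)
qed

text \<open>Monotone weights replace the conditioning on a downward closed set of restrictions in
  Hastad's proof of the switching lemma: fixing more variables can only increase the weight.\<close>

definition mono_weight :: "(('v \<rightharpoonup> bool) \<Rightarrow> real) \<Rightarrow> bool" where
  "mono_weight w \<longleftrightarrow> (\<forall>\<rho>. 0 \<le> w \<rho>) \<and> (\<forall>\<rho> \<rho>'. \<rho> \<subseteq>\<^sub>m \<rho>' \<longrightarrow> w \<rho> \<le> w \<rho>')"

lemma mono_weight_nonneg: "mono_weight w \<Longrightarrow> 0 \<le> w \<rho>"
  by (simp add: mono_weight_def)

lemma map_add_mono_left: "\<rho> \<subseteq>\<^sub>m \<rho>' \<Longrightarrow> \<rho> ++ \<sigma> \<subseteq>\<^sub>m \<rho>' ++ \<sigma>"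
  by (auto simp: map_le_def map_add_def split: option.splits)

lemma mono_weight_add: "mono_weight w \<Longrightarrow> mono_weight (\<lambda>\<rho>. w (\<rho> ++ \<sigma>))"
  by (simp add: mono_weight_def map_add_mono_left)

text \<open>A falsified term stays falsified under extension. The event that T is killed can
  therefore be absorbed into the weight before passing to the remaining terms.\<close>

lemma mono_weight_conflict:
  assumes "mono_weight w"
  shows "mono_weight (\<lambda>\<rho>. of_bool (conflict T (\<rho> ++ a)) * w \<rho>)"
proof -
  have "of_bool (conflict T (\<rho> ++ a)) * w \<rho> \<le> of_bool (conflict T (\<rho>' ++ a)) * w \<rho>'" if "\<rho> \<subseteq>\<^sub>m \<rho>'" for \<rho> \<rho>'
    using conflict_map_le[OF _ map_add_mono_left[OF that]] assms that
    by (auto simp: mono_weight_def)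
  then show ?thesis
    using assms by (simp add: mono_weight_def)
qed

text \<open>Induction over the terms; \<open>a\<close> and \<open>b\<close> are the answers so far
  for F and for the common tree. If T is killed, the event joins the weight w. If T survives with
  free set J, each restriction is compared with the one that also sets J according to T. By
  monotonicity w does not decrease, while the probability ratio is (2 p / (1 - p)) ^ card J.
  Together with 4 ^ card J pairs of answers and the cost z ^ card J this is at most (q y) ^ card J.
  The power of q pays for the path length; the powers of y, summed over nonempty J, give at most (1
  + y) ^ k - 1 \<le> 1. The assumption on A is the induction hypothesis of
  \<open>multi_switching\<close> for fewer variables.\<close>

lemma path_weight_bound:
  fixes A :: "('v \<rightharpoonup> bool) \<Rightarrow> real" and p q y z B :: real
  assumes N: "finite N" and A: "\<And>\<rho>. 0 \<le> A \<rho>"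
    and p: "0 < p" "p < 1" and z: "0 \<le> z" and B: "0 \<le> B"
    and q: "0 < q" "q \<le> 1" and y: "0 \<le> y" "(1 + y) ^ k \<le> 2" "8 * p * z \<le> (1 - p) * (q * y)"
    and F: "\<And>T. T \<in> set F \<Longrightarrow> dom T \<subseteq> N \<and> card (dom T) \<le> k"
    and V: "V \<subseteq> N" and dom: "dom a = N - V" "dom b = N - V" and w: "mono_weight w"
    and hyp: "\<And>V' b' w'. \<lbrakk>V' \<subset> V \<or> V' = V \<and> s = 0; dom b' = N - V'; mono_weight w'\<rbrakk> \<Longrightarrow>
      rsum (restr_weight p) V' (\<lambda>\<rho>. A (\<rho> ++ b') * w' \<rho>) \<le> B * rsum (restr_weight p) V' w'"
  shows "rsum (restr_weight p) V (\<lambda>\<rho>. path_weight z A F (\<rho> ++ a) (\<rho> ++ b) s * w \<rho>)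
    \<le> B * q ^ s * rsum (restr_weight p) V w"
  using F V dom w hyp
proof (induction F arbitrary: V a b w s)
  case (Nil V a b w s)
  have "0 \<le> rsum (restr_weight p) V w"
    using p by (intro rsum_nonneg restr_weight_nonneg mono_weight_nonneg[OF Nil.prems(5)]) auto
  moreover have "rsum (restr_weight p) V (\<lambda>\<rho>. 0) = 0"
    by (simp add: rsum_def)
  ultimately show ?case
    using B q Nil.prems(6)[OF _ Nil.prems(4,5)] by (cases s) simp_all
next
  case (Cons T F V a b w s)
  let ?E = "rsum (restr_weight p)"
  have rw: "0 \<le> restr_weight p y" for y
    using p by (intro restr_weight_nonneg) auto
  have wn: "0 \<le> w \<rho>" for \<rho>
    using Cons.prems(5) by (rule mono_weight_nonneg)
  have F: "\<And>T'. T' \<in> set F \<Longrightarrow> dom T' \<subseteq> N \<and> card (dom T') \<le> k"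
    using Cons.prems(1) by auto
  have fV: "finite V" using Cons.prems(2) N finite_subset by blast
  show ?case
  proof (cases s)
    case 0
    then show ?thesis
      using Cons.prems(6)[OF _ Cons.prems(4,5)] by simp
  next
    case (Suc r)
    define cf where "cf = (\<lambda>\<rho>. conflict T (\<rho> ++ a))"
    have wcf: "mono_weight (\<lambda>\<rho>. of_bool (cf \<rho>) * w \<rho>)"
      unfolding cf_def using Cons.prems(5) by (rule mono_weight_conflict)
    have killed: "?E V (\<lambda>\<rho>. path_weight z A F (\<rho> ++ a) (\<rho> ++ b) s * (of_bool (cf \<rho>) * w \<rho>))
      \<le> B * q ^ s * ?E V (\<lambda>\<rho>. of_bool (cf \<rho>) * w \<rho>)"
      using F Cons.prems(2-4) wcf Cons.prems(6) by (rule Cons.IH)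
    define X where "X = (\<lambda>\<rho>. of_bool (\<not> cf \<rho>) * path_weight z A (T # F) (\<rho> ++ a) (\<rho> ++ b) s * w \<rho>)"
    have "?E V (\<lambda>\<rho>. path_weight z A (T # F) (\<rho> ++ a) (\<rho> ++ b) s * w \<rho>)
      = ?E V (\<lambda>\<rho>. path_weight z A F (\<rho> ++ a) (\<rho> ++ b) s * (of_bool (cf \<rho>) * w \<rho>) + X \<rho>)"
      by (intro rsum_cong) (simp add: Suc X_def cf_def)
    also have "\<dots> = ?E V (\<lambda>\<rho>. path_weight z A F (\<rho> ++ a) (\<rho> ++ b) s * (of_bool (cf \<rho>) * w \<rho>)) + ?E V X"
      by (rule rsum_add)
    finally have split: "?E V (\<lambda>\<rho>. path_weight z A (T # F) (\<rho> ++ a) (\<rho> ++ b) s * w \<rho>) = \<dots>" .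
    have "?E V X \<le> B * q ^ s * ?E V (\<lambda>\<rho>. of_bool (\<not> cf \<rho>) * w \<rho>)"
    proof (cases "conflict T a")
      case True
      have "cf \<rho>" for \<rho>
        unfolding cf_def using True by (rule conflict_map_le) simp
      then show ?thesis by (simp add: X_def rsum_def)
    next
      case False
      define U where "U = dom T \<inter> V"
      define R where "R = (1 - p) / 2"
      have R: "0 < R" using p by (simp add: R_def)
      have T: "dom T \<subseteq> N" "card (dom T) \<le> k" using Cons.prems(1)[of T] by auto
      have fU: "finite U" using fV by (simp add: U_def)
      have UV: "U \<union> (V - U) = V" "U \<inter> (V - U) = {}" "U \<subseteq> dom T" by (auto simp: U_def)
      have "card U \<le> card (dom T)"
        using T N by (intro card_mono) (auto simp: U_def intro: finite_subset)
      then have cU: "card U \<le> k" using T by simp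
      have cfU: "cf (\<rho> ++ \<sigma>) = conflict T \<sigma>" if "dom \<sigma> \<subseteq> U" "dom \<rho> \<subseteq> V - U" for \<rho> \<sigma>
      proof -
        have "v \<notin> dom \<rho>" "v \<in> dom \<sigma> \<Longrightarrow> v \<notin> dom a" if "v \<in> dom T" for v
          using that \<open>dom \<sigma> \<subseteq> U\<close> \<open>dom \<rho> \<subseteq> V - U\<close> Cons.prems(3) by (auto simp: U_def)
        then have val: "((\<rho> ++ \<sigma>) ++ a) v = (if v \<in> dom a then a v else \<sigma> v)" if "v \<in> dom T" for v
          using that by (auto simp: map_add_def domIff split: option.splits)
        show ?thesis
        proof
          assume "cf (\<rho> ++ \<sigma>)"
          then obtain v where v: "v \<in> dom T" "v \<in> dom ((\<rho> ++ \<sigma>) ++ a)" "T v \<noteq> ((\<rho> ++ \<sigma>) ++ a) v"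
            unfolding cf_def conflict_def by (elim bexE IntE)
          show "conflict T \<sigma>"
          proof (cases "v \<in> dom a")
            case True
            then have "conflict T a" using v val[of v] unfolding conflict_def by auto
            then show ?thesis using False by blast
          next
            case False
            then show ?thesis using v val[of v] unfolding conflict_def domIff by auto
          qed
        next
          assume "conflict T \<sigma>"
          then obtain v where v: "v \<in> dom T" "v \<in> dom \<sigma>" "T v \<noteq> \<sigma> v"
            unfolding conflict_def by blast
          moreover have "v \<notin> dom a"
            using v that Cons.prems(3) by (auto simp: U_def)
          ultimately have "v \<in> dom T \<inter> dom ((\<rho> ++ \<sigma>) ++ a)" "T v \<noteq> ((\<rho> ++ \<sigma>) ++ a) v"
            using val[OF v(1)] by auto
          then show "cf (\<rho> ++ \<sigma>)"
            unfolding cf_def conflict_def by (rule bexI[rotated])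
        qed
      qed
      define G where "G = (\<lambda>g J. ?E (V - U) (\<lambda>\<rho>. g (\<rho> ++ T |` (U - J))))"
      have decomp: "?E V (\<lambda>\<rho>. of_bool (\<not> cf \<rho>) * g \<rho>) = (\<Sum>J\<in>Pow U. p ^ card J * R ^ card (U - J) * G g J)" for g
      proof -
        have "?E V (\<lambda>\<rho>. of_bool (\<not> cf \<rho>) * g \<rho>)
          = ?E U (\<lambda>\<sigma>. ?E (V - U) (\<lambda>\<rho>. of_bool (\<not> cf (\<rho> ++ \<sigma>)) * g (\<rho> ++ \<sigma>)))"
          using rsum_union[OF fU finite_Diff[OF fV] UV(2), of "restr_weight p" "\<lambda>\<rho>. of_bool (\<not> cf \<rho>) * g \<rho>"]
          unfolding UV(1) .
        also have "\<dots> = ?E U (\<lambda>\<sigma>. of_bool (\<not> conflict T \<sigma>) * ?E (V - U) (\<lambda>\<rho>. g (\<rho> ++ \<sigma>)))"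
          unfolding rsum_cmult[symmetric] using cfU by (intro rsum_cong) auto
        also have "\<dots> = (\<Sum>J\<in>Pow U. p ^ card J * R ^ card (U - J) * G g J)"
          unfolding G_def R_def by (rule rsum_matching[OF fU UV(3)])
        finally show ?thesis .
      qed
      \<comment> \<open>The weight of the restrictions that satisfy T on all of U, the common target
        of comparison for every J.\<close>
      define W where "W = ?E (V - U) (\<lambda>\<rho>. w (\<rho> ++ T |` U))"
      have W0: "0 \<le> W" unfolding W_def using wn rw by (intro rsum_nonneg)
      let ?g = "\<lambda>\<rho>. path_weight z A (T # F) (\<rho> ++ a) (\<rho> ++ b) s * w \<rho>"
      have Gbound: "p ^ card J * R ^ card (U - J) * G ?g J \<le> B * q ^ s * R ^ card U * W * (if J = {} then 0 else y ^ card J)"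
        if J: "J \<in> Pow U" for J
      proof -
        have dJ: "dom T - dom ((\<rho> ++ T |` (U - J)) ++ a) = J" if "dom \<rho> \<subseteq> V - U" for \<rho>
          using that J T(1) Cons.prems(2,3) by (auto simp: U_def)
        have nc: "\<not> conflict T ((\<rho> ++ T |` (U - J)) ++ a)" if "dom \<rho> \<subseteq> V - U" for \<rho>
        proof -
          have "dom (T |` (U - J)) \<subseteq> U" by auto
          from cfU[OF this that] show ?thesis
            by (auto simp: cf_def conflict_def restrict_map_def split: if_splits)
        qed
        show ?thesis
        proof (cases "J = {}")
          case True
          \<comment> \<open>With nothing left free, T is satisfied and the canonical path stops
            short of s queries.\<close>
          have "?g (\<rho> ++ T |` (U - J)) = 0" if "dom \<rho> \<subseteq> V - U" for \<rho>
          proof -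
            have "dom T \<subseteq> dom ((\<rho> ++ T |` (U - J)) ++ a)"
              using dJ[OF that] unfolding Diff_eq_empty_iff[symmetric] True .
            then show ?thesis
              using nc[OF that] by (simp only: Suc path_weight.simps if_False if_True mult_zero_left)
          qed
          then have "G ?g J = ?E (V - U) (\<lambda>\<rho>. 0)"
            unfolding G_def by (rule rsum_cong)
          then have "G ?g J = 0" by (simp add: rsum_def)
          then show ?thesis using True by simp
        next
          case False
          define j where "j = card J"
          have fJ: "finite J" using J fU finite_subset by blast
          define w' where "w' = (\<lambda>\<rho>. w (\<rho> ++ T |` (U - J)))"
          have w': "mono_weight w'"
            unfolding w'_def using Cons.prems(5) by (rule mono_weight_add)
          have sub: "V - U \<subset> V" using False J UV(1) by blast
          let ?M = "{\<tau> :: 'v \<rightharpoonup> bool. dom \<tau> = J}"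
          \<comment> \<open>The answers \<tau> and \<pi> are moved from the restriction into the
            fixed parts \<open>a\<close> and \<open>b\<close>, so that only \<open>V - U\<close>
            stays random. This is a proper subset of V since J is nonempty.\<close>
          let ?pw = "\<lambda>\<tau> \<pi> \<rho>. path_weight z A F (\<rho> ++ (T |` (U - J) ++ a ++ \<tau>)) (\<rho> ++ (T |` (U - J) ++ b ++ \<pi>)) (s - j)"
          have one: "?E (V - U) (\<lambda>\<rho>. ?pw \<tau> \<pi> \<rho> * w' \<rho>) \<le> B * q ^ (s - j) * W" if "\<tau> \<in> ?M" "\<pi> \<in> ?M" for \<tau> \<pi>
          proof -
            have "?E (V - U) (\<lambda>\<rho>. ?pw \<tau> \<pi> \<rho> * w' \<rho>) \<le> B * q ^ (s - j) * ?E (V - U) w'"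
            proof (rule Cons.IH[OF F _ _ _ w'])
              show "V - U \<subseteq> N" using Cons.prems(2) by blast
              show "dom (T |` (U - J) ++ a ++ \<tau>) = N - (V - U)" "dom (T |` (U - J) ++ b ++ \<pi>) = N - (V - U)"
                using that J Cons.prems(2-4) T(1) UV(3) by (auto simp: U_def)
              show "?E V' (\<lambda>\<rho>. A (\<rho> ++ b') * w'' \<rho>) \<le> B * ?E V' w''"
                if "V' \<subset> V - U \<or> V' = V - U \<and> s - j = 0" "dom b' = N - V'" "mono_weight w''" for V' b' w''
                using that sub by (intro Cons.prems(6)) auto
            qed
            also have "\<dots> \<le> B * q ^ (s - j) * W"
            proof (intro mult_left_mono)
              show "?E (V - U) w' \<le> W"
                unfolding W_def w'_def
              proof (intro rsum_mono rw)
                fix \<rho> :: "'v \<rightharpoonup> bool" assume "dom \<rho> \<subseteq> V - U"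
                then have "\<rho> v = None" if "v \<in> U" for v
                  using that by (auto simp: domIff subset_iff)
                then have "\<rho> ++ T |` (U - J) \<subseteq>\<^sub>m \<rho> ++ T |` U"
                  by (auto simp: map_le_def map_add_def restrict_map_def split: option.splits)
                then show "w (\<rho> ++ T |` (U - J)) \<le> w (\<rho> ++ T |` U)"
                  using Cons.prems(5) by (simp add: mono_weight_def)
              qed
            qed (use B q in auto)
            finally show ?thesis .
          qed
          have "G ?g J = ?E (V - U) (\<lambda>\<rho>. \<Sum>\<tau>\<in>?M. \<Sum>\<pi>\<in>?M. z ^ j * (?pw \<tau> \<pi> \<rho> * w' \<rho>))"
            unfolding G_def
          proof (rule rsum_cong)
            fix \<rho> :: "'v \<rightharpoonup> bool" assume \<rho>: "dom \<rho> \<subseteq> V - U"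
            have "\<not> dom T \<subseteq> dom ((\<rho> ++ T |` (U - J)) ++ a)"
              using dJ[OF \<rho>] False by (simp only: Diff_eq_empty_iff[symmetric] not_False_eq_True)
            then have "path_weight z A (T # F) ((\<rho> ++ T |` (U - J)) ++ a) ((\<rho> ++ T |` (U - J)) ++ b) s
              = (\<Sum>\<tau>\<in>?M. \<Sum>\<pi>\<in>?M. z ^ j * ?pw \<tau> \<pi> \<rho>)"
              using nc[OF \<rho>] by (simp only: Suc path_weight.simps if_False Let_def dJ[OF \<rho>] j_def map_add_assoc)
            then show "?g (\<rho> ++ T |` (U - J)) = (\<Sum>\<tau>\<in>?M. \<Sum>\<pi>\<in>?M. z ^ j * (?pw \<tau> \<pi> \<rho> * w' \<rho>))"
              by (simp add: w'_def sum_distrib_right mult.assoc)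
          qed
          also have "\<dots> = (\<Sum>\<tau>\<in>?M. \<Sum>\<pi>\<in>?M. z ^ j * ?E (V - U) (\<lambda>\<rho>. ?pw \<tau> \<pi> \<rho> * w' \<rho>))"
            by (simp only: rsum_sum rsum_cmult)
          also have "\<dots> \<le> (\<Sum>\<tau>\<in>?M. \<Sum>\<pi>\<in>?M. z ^ j * (B * q ^ (s - j) * W))"
            using one z by (intro sum_mono mult_left_mono) auto
          also have "\<dots> = 2 ^ j * 2 ^ j * z ^ j * (B * q ^ (s - j) * W)"
            by (simp add: card_maps_dom[OF fJ] j_def)
          \<comment> \<open>One factor 2 ^ j counts the answers on the path of F, the other those of
            the common tree.\<close>
          also have "\<dots> = (4 * z) ^ j * (B * q ^ (s - j) * W)"
          proof -
            have "(4 :: real) ^ j = 2 ^ j * 2 ^ j"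
              using power_mult_distrib[of "2 :: real" 2 j] by simp
            then show ?thesis by (simp only: power_mult_distrib mult_ac)
          qed
          finally have "G ?g J \<le> (4 * z) ^ j * (B * q ^ (s - j) * W)" .
          then have "p ^ j * R ^ card (U - J) * G ?g J \<le> p ^ j * R ^ card (U - J) * ((4 * z) ^ j * (B * q ^ (s - j) * W))"
            using p R by (intro mult_left_mono) auto
          also have "\<dots> = (4 * p * z) ^ j * q ^ (s - j) * (R ^ card (U - J) * B * W)"
            by (simp add: power_mult_distrib mult_ac)
          also have "\<dots> \<le> (R ^ j * y ^ j * q ^ s) * (R ^ card (U - J) * B * W)"
          proof (intro mult_right_mono)
            have "(4 * p * z) ^ j \<le> (R * (q * y)) ^ j"
              using y(3) p z by (intro power_mono) (auto simp: R_def)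
            then have "(4 * p * z) ^ j * q ^ (s - j) \<le> (R * (q * y)) ^ j * q ^ (s - j)"
              using q by (intro mult_right_mono) auto
            also have "\<dots> = R ^ j * y ^ j * q ^ (j + (s - j))"
              by (simp add: power_mult_distrib power_add)
            \<comment> \<open>For j > s the truncated difference makes j + (s - j) larger than s;
              \<open>q \<le> 1\<close> absorbs this.\<close>
            also have "\<dots> \<le> R ^ j * y ^ j * q ^ s"
              using q R y by (intro mult_left_mono power_decreasing) auto
            finally show "(4 * p * z) ^ j * q ^ (s - j) \<le> R ^ j * y ^ j * q ^ s" .
          qed (use R B W0 in auto)
          also have "\<dots> = B * q ^ s * (R ^ j * R ^ card (U - J)) * W * y ^ j"
            by (simp add: mult_ac)
          also have "R ^ j * R ^ card (U - J) = R ^ card U"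
          proof -
            have "card U = j + card (U - J)"
              using J fU card_Diff_subset[OF fJ, of U] card_mono[of U J] by (simp add: j_def)
            then show ?thesis by (simp add: power_add)
          qed
          finally show ?thesis using False by (simp add: j_def)
        qed
      qed
      have "?E V X = ?E V (\<lambda>\<rho>. of_bool (\<not> cf \<rho>) * ?g \<rho>)"
        unfolding X_def by (simp add: mult.assoc)
      also have "\<dots> = (\<Sum>J\<in>Pow U. p ^ card J * R ^ card (U - J) * G ?g J)"
        by (rule decomp)
      also have "\<dots> \<le> (\<Sum>J\<in>Pow U. B * q ^ s * R ^ card U * W * (if J = {} then 0 else y ^ card J))"
        using Gbound by (rule sum_mono)
      also have "\<dots> = B * q ^ s * R ^ card U * W * (\<Sum>J\<in>Pow U. if J = {} then 0 else y ^ card J)"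
        by (simp add: sum_distrib_left)
      also have "(\<Sum>J\<in>Pow U. if J = {} then 0 else y ^ card J) = (1 + y) ^ card U - 1"
      proof -
        have "(\<Sum>J\<in>Pow U. y ^ card J) = (\<Sum>J\<in>Pow U. (if J = {} then 0 else y ^ card J) + (if J = {} then 1 else 0))"
          by (intro sum.cong) auto
        also have "\<dots> = (\<Sum>J\<in>Pow U. if J = {} then 0 else y ^ card J) + 1"
          using fU by (simp add: sum.distrib)
        finally show ?thesis
          using sum_Pow_power[OF fU, of y] by simp
      qed
      also have "B * q ^ s * R ^ card U * W * ((1 + y) ^ card U - 1) \<le> B * q ^ s * R ^ card U * W * 1"
      proof (intro mult_left_mono)
        have "(1 + y) ^ card U \<le> (1 + y) ^ k"
          using cU y by (intro power_increasing) auto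
        then show "(1 + y) ^ card U - 1 \<le> 1"
          using y by simp
      qed (use B q R W0 in auto)
      \<comment> \<open>The bound is the term \<open>J = {}\<close> in the decomposition of w
        itself: the restrictions satisfying T pay for all the others.\<close>
      also have "\<dots> = B * q ^ s * (p ^ card ({} :: 'v set) * R ^ card (U - {}) * G w {})"
        by (simp add: G_def W_def)
      also have "\<dots> \<le> B * q ^ s * (\<Sum>J\<in>Pow U. p ^ card J * R ^ card (U - J) * G w J)"
      proof (intro mult_left_mono member_le_sum[where f = "\<lambda>J. p ^ card J * R ^ card (U - J) * G w J"])
        show "0 \<le> p ^ card J * R ^ card (U - J) * G w J" for J
          unfolding G_def using p R wn rw by (intro mult_nonneg_nonneg rsum_nonneg) auto
      qed (use fU B q in auto)
      also have "\<dots> = B * q ^ s * ?E V (\<lambda>\<rho>. of_bool (\<not> cf \<rho>) * w \<rho>)"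
        by (simp only: decomp)
      finally show ?thesis .
    qed
    with killed split have "?E V (\<lambda>\<rho>. path_weight z A (T # F) (\<rho> ++ a) (\<rho> ++ b) s * w \<rho>)
        \<le> B * q ^ s * (?E V (\<lambda>\<rho>. of_bool (cf \<rho>) * w \<rho>) + ?E V (\<lambda>\<rho>. of_bool (\<not> cf \<rho>) * w \<rho>))"
      by (simp add: distrib_left)
    also have "?E V (\<lambda>\<rho>. of_bool (cf \<rho>) * w \<rho>) + ?E V (\<lambda>\<rho>. of_bool (\<not> cf \<rho>) * w \<rho>) = ?E V w"
      unfolding rsum_add[symmetric] by (intro rsum_cong) auto
    finally show ?thesis .
  qed
qed

text \<open>Either P already holds and the depth is 0, or some member of the family is bad. In the
  second case the common tree asks the queries of a long canonical path of that member and continues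
  recursively on fewer variables, again at cost B. A union bound over I gives 1 + card I * q ^ Suc r
  * B, and the condition on B makes it a fixed point of this recursion. The weight w is carried
  along because the recursion happens under the conditioning on killed terms.\<close>

lemma multi_switching:
  fixes F :: "'i \<Rightarrow> ('v \<rightharpoonup> bool) list" and p q y z B :: real
  assumes N: "finite N" and I: "finite I" and p: "0 < p" "p < 1" and z: "1 \<le> z" and B: "0 \<le> B"
    and q: "0 < q" "q \<le> 1" and y: "0 \<le> y" "(1 + y) ^ k \<le> 2" "8 * p * z \<le> (1 - p) * (q * y)"
    and F: "\<And>i T. i \<in> I \<Longrightarrow> T \<in> set (F i) \<Longrightarrow> dom T \<subseteq> N \<and> card (dom T) \<le> k"
    and m: "card I * q ^ Suc r * B \<le> B - 1"
    and V: "V \<subseteq> N" and dom: "dom b = N - V" and w: "mono_weight w"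
  defines "P \<equiv> \<lambda>\<rho>. \<forall>i\<in>I. query_tree N r (forced N (dnf (F i))) \<rho>"
  shows "rsum (restr_weight p) V (\<lambda>\<rho>. z ^ query_depth N P (\<rho> ++ b) * w \<rho>) \<le> B * rsum (restr_weight p) V w"
proof -
  let ?E = "rsum (restr_weight p)"
  let ?A = "\<lambda>\<rho>. z ^ query_depth N P \<rho>"
  have rw: "0 \<le> restr_weight p y" for y
    using p by (intro restr_weight_nonneg) auto
  have Ptot: "P \<sigma>" if "dom \<sigma> = N" for \<sigma>
    unfolding P_def using query_tree_leaf[of "forced N (dnf (F i))" \<sigma> N r for i] forced_total[OF that] by blast
  have fV: "finite V" using V N finite_subset by blast
  show ?thesis
    using fV V dom w
  proof (induction V arbitrary: b w rule: finite_psubset_induct)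
    case (psubset V)
    have wn: "0 \<le> w \<rho>" for \<rho>
      using psubset.prems(3) by (rule mono_weight_nonneg)
    have one: "?E V (\<lambda>\<rho>. path_weight z ?A (F i) (\<rho> ++ b) (\<rho> ++ b) (Suc r) * w \<rho>) \<le> B * q ^ Suc r * ?E V w"
      if i: "i \<in> I" for i
    proof (rule path_weight_bound[OF N _ p _ B q y F[OF i] psubset.prems(1,2,2,3)])
      \<comment> \<open>A path of positive length queries at least one variable before A is
        evaluated, so only proper subsets of V occur.\<close>
      show "?E V' (\<lambda>\<rho>. ?A (\<rho> ++ b') * w' \<rho>) \<le> B * ?E V' w'"
        if "V' \<subset> V \<or> V' = V \<and> Suc r = 0" "dom b' = N - V'" "mono_weight w'" for V' b' w'
        using that psubset.prems(1) by (intro psubset.IH) auto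
    qed (use z in auto)
    have "?E V (\<lambda>\<rho>. ?A (\<rho> ++ b) * w \<rho>)
      \<le> ?E V (\<lambda>\<rho>. w \<rho> + (\<Sum>i\<in>I. path_weight z ?A (F i) (\<rho> ++ b) (\<rho> ++ b) (Suc r) * w \<rho>))"
    proof (intro rsum_mono rw)
      fix \<rho> :: "'v \<rightharpoonup> bool" assume \<rho>: "dom \<rho> \<subseteq> V"
      let ?pw = "\<lambda>i. path_weight z ?A (F i) (\<rho> ++ b) (\<rho> ++ b) (Suc r)"
      have pw: "0 \<le> ?pw i" for i
        using z by (intro path_weight_nonneg) auto
      have "?A (\<rho> ++ b) \<le> 1 + (\<Sum>i\<in>I. ?pw i)"
      proof (cases "P (\<rho> ++ b)")
        case True
        then have "query_depth N P (\<rho> ++ b) \<le> 0"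
          by (intro query_depth_le) simp
        then show ?thesis using pw by (simp add: sum_nonneg)
      next
        case False
        then obtain i where i: "i \<in> I" "\<not> query_tree N r (forced N (dnf (F i))) (\<rho> ++ b)"
          unfolding P_def by blast
        have "?A (\<rho> ++ b) \<le> ?pw i"
        proof (rule path_weight_ge[OF N Ptot z])
          show "dom (\<rho> ++ b) \<subseteq> N"
            using \<rho> psubset.prems(1,2) by auto
        qed (use i F in simp_all)
        also have "\<dots> \<le> (\<Sum>i\<in>I. ?pw i)"
          using i(1) I pw by (intro member_le_sum) auto
        finally show ?thesis by simp
      qed
      then have "?A (\<rho> ++ b) * w \<rho> \<le> (1 + (\<Sum>i\<in>I. ?pw i)) * w \<rho>"
        using wn by (rule mult_right_mono)
      then show "?A (\<rho> ++ b) * w \<rho> \<le> w \<rho> + (\<Sum>i\<in>I. ?pw i * w \<rho>)"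
        by (simp add: distrib_right sum_distrib_right)
    qed
    also have "\<dots> = ?E V w + (\<Sum>i\<in>I. ?E V (\<lambda>\<rho>. path_weight z ?A (F i) (\<rho> ++ b) (\<rho> ++ b) (Suc r) * w \<rho>))"
      by (simp only: rsum_add rsum_sum)
    also have "\<dots> \<le> ?E V w + (\<Sum>i\<in>I. B * q ^ Suc r * ?E V w)"
      using one by (intro add_left_mono sum_mono)
    also have "\<dots> = (1 + card I * q ^ Suc r * B) * ?E V w"
      by (simp add: algebra_simps)
    also have "\<dots> \<le> B * ?E V w"
      using m wn rw by (intro mult_right_mono rsum_nonneg) auto
    finally show ?case .
  qed
qed

section \<open>Composing restrictions\<close>

lemma query_depth_var:
  fixes z :: real
  assumes "finite N" "dom \<rho> \<subseteq> N" "\<And>\<sigma>. dom \<sigma> = N \<Longrightarrow> P \<sigma>" "1 \<le> z" "v \<in> N - dom \<rho>"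
  shows "z ^ query_depth N P \<rho>
    \<le> z * (z ^ query_depth N P (\<rho>(v \<mapsto> False)) + z ^ query_depth N P (\<rho>(v \<mapsto> True)))"
proof -
  let ?d = "\<lambda>b. query_depth N P (\<rho>(v \<mapsto> b))"
  define m where "m = max (?d False) (?d True)"
  have "query_tree N m P (\<rho>(v \<mapsto> b))" for b
  proof (rule query_tree_weaken)
    show "query_tree N (?d b) P (\<rho>(v \<mapsto> b))"
      using assms(2,5) by (intro query_tree_depth assms(1,3)) auto
    show "?d b \<le> m" by (cases b) (simp_all add: m_def)
  qed
  then have "query_tree N (Suc m) P \<rho>"
    unfolding query_tree.simps using assms(5) by blast
  then have "query_depth N P \<rho> \<le> Suc m"
    by (rule query_depth_le)
  then have "z ^ query_depth N P \<rho> \<le> z * z ^ m"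
    using assms(4) power_increasing[of "query_depth N P \<rho>" "Suc m" z] by simp
  also have "z ^ m \<le> z ^ ?d False + z ^ ?d True"
    using assms(4) by (auto simp: m_def max_def)
  finally show ?thesis
    using assms(4) by simp
qed

text \<open>A queried variable that the restriction has already fixed costs nothing, so each query costs
  only a factor \<open>1 + 2 p z\<close> on average instead of \<open>2 z\<close>.\<close>

lemma restrict_query_tree:
  fixes z B p :: real
  assumes "finite N" "\<And>\<sigma>. dom \<sigma> = N \<Longrightarrow> P' \<sigma>" "1 \<le> z" "0 \<le> p" "p \<le> 1" "0 \<le> B"
    and leaf: "\<And>\<rho>. dom \<rho> \<subseteq> N \<Longrightarrow> P \<rho> \<Longrightarrow>
      rsum (restr_weight p) (N - dom \<rho>) (\<lambda>\<sigma>. z ^ query_depth N P' (\<sigma> ++ \<rho>)) \<le> B"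
    and "query_tree N t P \<rho>" "dom \<rho> \<subseteq> N"
  shows "rsum (restr_weight p) (N - dom \<rho>) (\<lambda>\<sigma>. z ^ query_depth N P' (\<sigma> ++ \<rho>)) \<le> (1 + 2 * p * z) ^ t * B"
  using assms(8,9)
proof (induction t arbitrary: \<rho>)
  case 0
  then show ?case using leaf by simp
next
  case (Suc t)
  let ?E = "rsum (restr_weight p)"
  define Y where "Y = (1 + 2 * p * z) ^ t * B"
  have ge1: "1 \<le> 1 + 2 * p * z" using assms(3,4) by simp
  have Y: "0 \<le> Y" "Y \<le> (1 + 2 * p * z) ^ Suc t * B"
    using ge1 assms(6) mult_right_mono[OF ge1, of "(1 + 2 * p * z) ^ t * B"]
    by (simp_all add: Y_def mult.assoc)
  show ?case
  proof (cases "P \<rho>")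
    case True
    have "1 \<le> (1 + 2 * p * z) ^ Suc t"
      using ge1 by (rule one_le_power)
    then have "B \<le> (1 + 2 * p * z) ^ Suc t * B"
      using assms(6) mult_right_mono[of 1 "(1 + 2 * p * z) ^ Suc t" B] by simp
    then show ?thesis
      using leaf[OF Suc.prems(2) True] by simp
  next
    case False
    then obtain v where v: "v \<in> N - dom \<rho>" "\<And>b. query_tree N t P (\<rho>(v \<mapsto> b))"
      using Suc.prems(1) by auto
    define V where "V = N - insert v (dom \<rho>)"
    have V: "N - dom \<rho> = insert v V" "v \<notin> V" "finite V" "\<And>b. N - dom (\<rho>(v \<mapsto> b)) = V"
      using v(1) assms(1) by (auto simp: V_def)
    let ?h = "\<lambda>\<rho> \<sigma>. z ^ query_depth N P' (\<sigma> ++ \<rho>)"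
    define X where "X = (\<lambda>b. ?E V (?h (\<rho>(v \<mapsto> b))))"
    have X: "X b \<le> Y" for b
    proof -
      have "dom (\<rho>(v \<mapsto> b)) \<subseteq> N"
        using v(1) Suc.prems(2) by auto
      from Suc.IH[OF v(2) this] show ?thesis
        unfolding V(4) X_def Y_def .
    qed
    have upd: "\<sigma>(v \<mapsto> b) ++ \<rho> = \<sigma> ++ \<rho>(v \<mapsto> b)" for \<sigma> b
      using v(1) by (simp add: map_add_upd_left)
    have "?E V (?h \<rho>) \<le> ?E V (\<lambda>\<sigma>. z * (?h (\<rho>(v \<mapsto> False)) \<sigma> + ?h (\<rho>(v \<mapsto> True)) \<sigma>))"
    proof (intro rsum_mono restr_weight_nonneg assms(4,5))
      fix \<sigma> :: "'a \<rightharpoonup> bool" assume "dom \<sigma> \<subseteq> V"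
      then have "dom (\<sigma> ++ \<rho>) \<subseteq> N" "v \<in> N - dom (\<sigma> ++ \<rho>)"
        using v(1) Suc.prems(2) by (auto simp: V_def)
      from query_depth_var[OF assms(1) this(1) assms(2,3) this(2)]
      show "?h \<rho> \<sigma> \<le> z * (?h (\<rho>(v \<mapsto> False)) \<sigma> + ?h (\<rho>(v \<mapsto> True)) \<sigma>)"
        by simp
    qed
    also have "\<dots> = z * (X False + X True)"
      by (simp only: rsum_cmult rsum_add X_def)
    finally have star: "?E V (?h \<rho>) \<le> z * (X False + X True)" .
    have "?E (N - dom \<rho>) (?h \<rho>) = p * ?E V (?h \<rho>) + (1 - p) / 2 * X False + (1 - p) / 2 * X True"
      unfolding V(1) rsum_insert[OF V(3,2)] upd X_def by (simp add: restr_weight_def)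
    also have "\<dots> \<le> p * (z * (X False + X True)) + (1 - p) / 2 * X False + (1 - p) / 2 * X True"
      using mult_left_mono[OF star assms(4)] by simp
    also have "\<dots> = (p * z + (1 - p) / 2) * (X False + X True)"
      by (simp add: field_simps)
    also have "\<dots> \<le> (p * z + (1 - p) / 2) * (Y + Y)"
      using X assms(3,4,5) by (intro mult_left_mono add_mono) auto
    also have "\<dots> = (1 + 2 * p * z) * Y - p * Y"
      by (simp add: field_simps)
    also have "\<dots> \<le> (1 + 2 * p * z) ^ Suc t * B"
      using assms(4) Y(1) by (simp add: Y_def mult.assoc)
    finally show ?thesis .
  qed
qed

text \<open>Jensen's inequality for a variable equal to 1 with probability 3/4 and to 4 with
  probability 1/4: its mean is 7/4.\<close>

lemma power_le_mean:
  "(7 / 4 :: real) ^ n \<le> (3 + 4 ^ n) / 4"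
proof (induction n)
  case (Suc n)
  have "(7 / 4 :: real) ^ Suc n \<le> 7 / 4 * ((3 + 4 ^ n) / 4)"
    using Suc by simp
  also have "\<dots> \<le> (3 + 4 ^ Suc n) / 4"
    using one_le_power[of "4 :: real" n] by simp
  finally show ?case .
qed simp

text \<open>The old common tree is asked first, at a factor 1 + 8 p' \<le> 7/4 per query, and the
  trees of the new level follow at its leaves. The expectation is at most 3/2 times the moment to
  base 7/4, hence at most 9/8 + 3/8 * 2 = 15/8, so the bound 2 reproduces itself.\<close>

lemma restrict_step:
  fixes p p' :: real
  assumes "finite N" "\<And>\<sigma>. dom \<sigma> = N \<Longrightarrow> P \<sigma>" "\<And>\<sigma>. dom \<sigma> = N \<Longrightarrow> P' \<sigma>"
    and p: "0 \<le> p" "p \<le> 1" "0 \<le> p'" "p' \<le> 3 / 32"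
    and leaf: "\<And>\<rho>. dom \<rho> \<subseteq> N \<Longrightarrow> P \<rho> \<Longrightarrow>
      rsum (restr_weight p') (N - dom \<rho>) (\<lambda>\<sigma>. 4 ^ query_depth N P' (\<sigma> ++ \<rho>)) \<le> 3 / 2"
    and E: "rsum (restr_weight p) N (\<lambda>\<rho>. 4 ^ query_depth N P \<rho>) \<le> 2"
  shows "rsum (restr_weight (p * p')) N (\<lambda>\<rho>. 4 ^ query_depth N P' \<rho>) \<le> 2"
proof -
  have "rsum (restr_weight (p * p')) N (\<lambda>\<rho>. 4 ^ query_depth N P' \<rho>)
    = rsum (restr_weight p) N (\<lambda>\<rho>. rsum (restr_weight p') (N - dom \<rho>) (\<lambda>\<sigma>. 4 ^ query_depth N P' (\<sigma> ++ \<rho>)))"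
    using rsum_comp[OF assms(1) restr_weight_total[of p'], of "restr_weight p" "\<lambda>\<rho>. 4 ^ query_depth N P' \<rho>"]
    unfolding comp_restr_restr by (rule sym)
  also have "\<dots> \<le> rsum (restr_weight p) N (\<lambda>\<rho>. 9 / 8 + 3 / 8 * 4 ^ query_depth N P \<rho>)"
  proof (intro rsum_mono restr_weight_nonneg p)
    fix \<rho> :: "'a \<rightharpoonup> bool" assume \<rho>: "dom \<rho> \<subseteq> N"
    have "rsum (restr_weight p') (N - dom \<rho>) (\<lambda>\<sigma>. 4 ^ query_depth N P' (\<sigma> ++ \<rho>))
      \<le> (1 + 2 * p' * 4) ^ query_depth N P \<rho> * (3 / 2)"
      using p by (intro restrict_query_tree[OF assms(1,3) _ _ _ _ leaf query_tree_depth[OF assms(1) \<rho> assms(2)] \<rho>]) simp_all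
    also have "\<dots> \<le> (7 / 4) ^ query_depth N P \<rho> * (3 / 2)"
      using p by (intro mult_right_mono power_mono) auto
    also have "\<dots> \<le> 9 / 8 + 3 / 8 * 4 ^ query_depth N P \<rho>"
      using power_le_mean[of "query_depth N P \<rho>"] by simp
    finally show "rsum (restr_weight p') (N - dom \<rho>) (\<lambda>\<sigma>. 4 ^ query_depth N P' (\<sigma> ++ \<rho>))
      \<le> 9 / 8 + 3 / 8 * 4 ^ query_depth N P \<rho>" .
  qed
  also have "\<dots> = 9 / 8 + 3 / 8 * rsum (restr_weight p) N (\<lambda>\<rho>. 4 ^ query_depth N P \<rho>)"
    by (simp only: rsum_add rsum_cmult rsum_const[OF assms(1) restr_weight_total])
  also have "\<dots> \<le> 2"
    using E by simp
  finally show ?thesis .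
qed

text \<open>Either answer to a query has probability at most (1 + 2 \<beta>) / 2, that is, at most 1
  + 2 \<beta> times its uniform probability. At a leaf f is constant and the bias has no
  effect.\<close>

lemma bias_query_tree:
  assumes "finite N" "0 \<le> \<beta>" "\<beta> \<le> 1 / 2" "query_tree N t (forced N f) \<rho>" "dom \<rho> \<subseteq> N"
  shows "rsum (bias_weight \<beta>) (N - dom \<rho>) (\<lambda>\<sigma>. of_bool (f (\<sigma> ++ \<rho>)))
    \<le> (1 + 2 * \<beta>) ^ t * rsum (bias_weight 0) (N - dom \<rho>) (\<lambda>\<sigma>. of_bool (f (\<sigma> ++ \<rho>)))"
proof -
  let ?E = "\<lambda>\<beta>. rsum (bias_weight \<beta>)"
  have nonneg: "0 \<le> ?E 0 V (\<lambda>\<sigma>. of_bool (f (\<sigma> ++ \<rho>)))" for V \<rho>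
    by (intro rsum_nonneg bias_weight_nonneg) auto
  have const: "?E \<beta> (N - dom \<rho>) (\<lambda>\<sigma>. of_bool (f (\<sigma> ++ \<rho>)))
      \<le> (1 + 2 * \<beta>) ^ t * ?E 0 (N - dom \<rho>) (\<lambda>\<sigma>. of_bool (f (\<sigma> ++ \<rho>)))"
    if "forced N f \<rho>" "dom \<rho> \<subseteq> N" for t \<rho>
  proof -
    obtain c where c: "\<And>\<sigma>. \<rho> \<subseteq>\<^sub>m \<sigma> \<Longrightarrow> dom \<sigma> = N \<Longrightarrow> f \<sigma> = c"
      using \<open>forced N f \<rho>\<close> unfolding forced_def by (elim exE) blast
    have eq: "?E \<gamma> (N - dom \<rho>) (\<lambda>\<sigma>. of_bool (f (\<sigma> ++ \<rho>))) = of_bool c" for \<gamma>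
    proof -
      have "?E \<gamma> (N - dom \<rho>) (\<lambda>\<sigma>. of_bool (f (\<sigma> ++ \<rho>))) = ?E \<gamma> (N - dom \<rho>) (\<lambda>\<sigma>. of_bool c)"
      proof (rule rsum_bias_cong)
        fix \<sigma> :: "'a \<rightharpoonup> bool" assume "dom \<sigma> = N - dom \<rho>"
        then have "dom (\<sigma> ++ \<rho>) = N" using \<open>dom \<rho> \<subseteq> N\<close> by auto
        then have "f (\<sigma> ++ \<rho>) = c" by (intro c map_le_map_add)
        then show "of_bool (f (\<sigma> ++ \<rho>)) = (of_bool c :: real)" by simp
      qed (use assms(1) in simp)
      also have "\<dots> = of_bool c"
        using assms(1) by (intro rsum_const bias_weight_total) simp
      finally show ?thesis .
    qed
    show ?thesis
      unfolding eq using assms(2) by simp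
  qed
  show ?thesis
    using assms(4,5)
  proof (induction t arbitrary: \<rho>)
    case 0
    then show ?case using const[of \<rho> 0] by simp
  next
    case (Suc t)
    show ?case
    proof (cases "forced N f \<rho>")
      case True
      then show ?thesis using Suc.prems(2) by (rule const)
    next
      case False
      then obtain v where v: "v \<in> N - dom \<rho>" "\<And>b. query_tree N t (forced N f) (\<rho>(v \<mapsto> b))"
        using Suc.prems(1) by auto
      define V where "V = N - insert v (dom \<rho>)"
      have V: "N - dom \<rho> = insert v V" "v \<notin> V" "finite V" "\<And>b. N - dom (\<rho>(v \<mapsto> b)) = V"
        using v(1) assms(1) by (auto simp: V_def)
      have upd: "\<sigma>(v \<mapsto> b) ++ \<rho> = \<sigma> ++ \<rho>(v \<mapsto> b)" for \<sigma> b
        using v(1) by (simp add: map_add_upd_left)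
      define X where "X = (\<lambda>\<gamma> b. ?E \<gamma> V (\<lambda>\<sigma>. of_bool (f (\<sigma> ++ \<rho>(v \<mapsto> b)))))"
      have eq: "?E \<gamma> (N - dom \<rho>) (\<lambda>\<sigma>. of_bool (f (\<sigma> ++ \<rho>)))
        = (1 / 2 + \<gamma>) * X \<gamma> False + (1 / 2 - \<gamma>) * X \<gamma> True" for \<gamma>
        unfolding V(1) rsum_insert[OF V(3,2)] upd X_def by (simp add: bias_weight_def)
      have X: "X \<beta> b \<le> (1 + 2 * \<beta>) ^ t * X 0 b" for b
      proof -
        have "dom (\<rho>(v \<mapsto> b)) \<subseteq> N"
          using v(1) Suc.prems(2) by auto
        from Suc.IH[OF v(2) this] show ?thesis
          unfolding V(4) X_def .
      qed
      have X0: "0 \<le> X 0 b" for b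
        unfolding X_def by (rule nonneg)
      have "(1 / 2 + \<beta>) * X \<beta> False + (1 / 2 - \<beta>) * X \<beta> True
        \<le> (1 / 2 + \<beta>) * ((1 + 2 * \<beta>) ^ t * X 0 False) + (1 / 2 + \<beta>) * ((1 + 2 * \<beta>) ^ t * X 0 True)"
      proof (rule add_mono)
        show "(1 / 2 + \<beta>) * X \<beta> False \<le> (1 / 2 + \<beta>) * ((1 + 2 * \<beta>) ^ t * X 0 False)"
          using X assms(2) by (intro mult_left_mono) auto
        have "(1 / 2 - \<beta>) * X \<beta> True \<le> (1 / 2 - \<beta>) * ((1 + 2 * \<beta>) ^ t * X 0 True)"
          using X assms(3) by (intro mult_left_mono) auto
        also have "\<dots> \<le> (1 / 2 + \<beta>) * ((1 + 2 * \<beta>) ^ t * X 0 True)"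
          using X0 assms(2) by (intro mult_right_mono) auto
        finally show "(1 / 2 - \<beta>) * X \<beta> True \<le> (1 / 2 + \<beta>) * ((1 + 2 * \<beta>) ^ t * X 0 True)" .
      qed
      also have "\<dots> = (1 + 2 * \<beta>) ^ Suc t * (1 / 2 * X 0 False + 1 / 2 * X 0 True)"
        by (simp add: algebra_simps)
      finally show ?thesis
        unfolding eq by simp
    qed
  qed
qed

text \<open>Below depth M the multiplicative loss is at most 1 / \<delta>. Otherwise the trivial
  bound 1 is charged to the moment as in Markov's inequality. Charging to 4 ^ D - 1 instead of 4 ^ D
  leaves expectation at most 1, so the error is 2 powr (- M) without a constant.\<close>

lemma bias_restricted_bound:
  fixes M \<delta> :: real
  assumes N: "finite N" and p: "0 < p" "p \<le> 1" and \<beta>: "0 \<le> \<beta>" "\<beta> \<le> 1 / 2"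
    and \<delta>: "0 \<le> \<delta>" "\<delta> \<le> 1" and M: "0 < M" "\<And>t. real t < M \<Longrightarrow> \<delta> * (1 + 2 * \<beta>) ^ t \<le> 1"
    and E: "rsum (restr_weight p) N (\<lambda>\<rho>. 4 ^ query_depth N (forced N f) \<rho>) \<le> 2"
  shows "\<delta> * rsum (bias_weight (p * \<beta>)) N (\<lambda>\<sigma>. of_bool (f \<sigma>))
    \<le> rsum (bias_weight 0) N (\<lambda>\<sigma>. of_bool (f \<sigma>)) + 2 powr (- M)"
proof -
  let ?B = "\<lambda>\<gamma> \<rho>. rsum (bias_weight \<gamma>) (N - dom \<rho>) (\<lambda>\<sigma>. of_bool (f (\<sigma> ++ \<rho>)) :: real)"
  let ?D = "query_depth N (forced N f)"
  have comp: "rsum (bias_weight (p * \<gamma>)) N (\<lambda>\<sigma>. of_bool (f \<sigma>)) = rsum (restr_weight p) N (?B \<gamma>)" for \<gamma>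
    using rsum_comp[OF N bias_weight_total[of \<gamma>], of "restr_weight p" "\<lambda>\<sigma>. of_bool (f \<sigma>)"]
    unfolding comp_restr_bias by (rule sym)
  have "\<delta> * rsum (bias_weight (p * \<beta>)) N (\<lambda>\<sigma>. of_bool (f \<sigma>)) = rsum (restr_weight p) N (\<lambda>\<rho>. \<delta> * ?B \<beta> \<rho>)"
    unfolding comp by (rule rsum_cmult[symmetric])
  also have "\<dots> \<le> rsum (restr_weight p) N (\<lambda>\<rho>. ?B 0 \<rho> + 2 powr (- M) * (4 ^ ?D \<rho> + (- 1)))"
  proof (intro rsum_mono restr_weight_nonneg)
    fix \<rho> :: "'a \<rightharpoonup> bool" assume \<rho>: "dom \<rho> \<subseteq> N"
    have B0: "0 \<le> ?B 0 \<rho>"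
      by (intro rsum_nonneg bias_weight_nonneg) auto
    show "\<delta> * ?B \<beta> \<rho> \<le> ?B 0 \<rho> + 2 powr (- M) * (4 ^ ?D \<rho> + (- 1))"
    proof (cases "real (?D \<rho>) < M")
      case True
      have "\<delta> * ?B \<beta> \<rho> \<le> \<delta> * ((1 + 2 * \<beta>) ^ ?D \<rho> * ?B 0 \<rho>)"
        using \<delta> by (intro mult_left_mono bias_query_tree[OF N \<beta> query_tree_depth[OF N \<rho> forced_total] \<rho>])
      also have "\<dots> \<le> 1 * ?B 0 \<rho>"
        unfolding mult.assoc[symmetric] using M(2)[OF True] B0 by (intro mult_right_mono)
      finally show ?thesis
        by (simp add: add_increasing2)
    next
      case False
      then have D: "M \<le> real (?D \<rho>)" "?D \<rho> > 0" using M(1) by auto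
      have "?B \<beta> \<rho> \<le> rsum (bias_weight \<beta>) (N - dom \<rho>) (\<lambda>\<sigma>. 1)"
        using \<beta> by (intro rsum_mono bias_weight_nonneg) auto
      also have "\<dots> = 1"
        using N by (intro rsum_const bias_weight_total) auto
      finally have "\<delta> * ?B \<beta> \<rho> \<le> \<delta> * 1"
        using \<delta>(1) by (rule mult_left_mono)
      also have "\<dots> \<le> 2 powr (- M) * 2 powr real (?D \<rho>)"
        using \<delta> D by (simp add: powr_add[symmetric] ge_one_powr_ge_zero order_trans[OF \<delta>(2)])
      also have "2 powr real (?D \<rho>) = 2 ^ ?D \<rho>"
        by (simp add: powr_realpow)
      also have "(2 :: real) ^ ?D \<rho> \<le> 4 ^ ?D \<rho> + (- 1)"
      proof -
        define X :: real where "X = 2 ^ ?D \<rho>"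
        have "2 \<le> X"
          using D(2) power_increasing[of 1 "?D \<rho>" "2 :: real"] by (simp add: X_def)
        then have "2 * X \<le> X * X" by (intro mult_right_mono) auto
        moreover have "X * X = 4 ^ ?D \<rho>"
          by (simp add: X_def power_mult_distrib[symmetric])
        ultimately show ?thesis using \<open>2 \<le> X\<close> unfolding X_def by simp
      qed
      finally show ?thesis
        using B0 by (simp add: mult_left_mono)
    qed
  qed (use p in auto)
  also have "\<dots> = rsum (restr_weight p) N (?B 0) + 2 powr (- M) * (rsum (restr_weight p) N (\<lambda>\<rho>. 4 ^ ?D \<rho>) + (- 1))"
    by (simp only: rsum_add rsum_cmult rsum_const[OF N restr_weight_total])
  also have "rsum (restr_weight p) N (?B 0) = rsum (bias_weight 0) N (\<lambda>\<sigma>. of_bool (f \<sigma>))"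
    using comp[of 0] by simp
  also have "2 powr (- M) * (rsum (restr_weight p) N (\<lambda>\<rho>. 4 ^ ?D \<rho>) + (- 1)) \<le> 2 powr (- M) * 1"
    using E by (intro mult_left_mono) auto
  finally show ?thesis by simp
qed

lemma total_query_tree:
  assumes "dom \<sigma> = N"
  shows "query_tree N t (forced N f) \<sigma>"
  by (rule query_tree_leaf[of "forced N f", OF forced_total[OF assms]])

section \<open>Switching circuits level by level\<close>

text \<open>The terms are the branches that end in leaves with value c. Having this for both values
  of c lets AND gates be treated through their negations.\<close>

lemma query_tree_imp_dnf:
  assumes "query_tree N k (forced N f) \<rho>"
  shows "\<exists>F. (\<forall>T\<in>set F. dom T \<subseteq> N - dom \<rho> \<and> card (dom T) \<le> k)
    \<and> (\<forall>\<sigma>. \<rho> \<subseteq>\<^sub>m \<sigma> \<longrightarrow> dom \<sigma> = N \<longrightarrow> (f \<sigma> = c) = dnf F \<sigma>)"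
proof -
  have const: "\<exists>F. (\<forall>T\<in>set F. dom T \<subseteq> N - dom \<rho> \<and> card (dom T) \<le> k)
    \<and> (\<forall>\<sigma>. \<rho> \<subseteq>\<^sub>m \<sigma> \<longrightarrow> dom \<sigma> = N \<longrightarrow> (f \<sigma> = c) = dnf F \<sigma>)"
    if "forced N f \<rho>" for k \<rho>
  proof -
    obtain e where e: "\<forall>\<sigma>. \<rho> \<subseteq>\<^sub>m \<sigma> \<longrightarrow> dom \<sigma> = N \<longrightarrow> f \<sigma> = e"
      using \<open>forced N f \<rho>\<close> unfolding forced_def by (elim exE)
    show ?thesis
      \<comment> \<open>The empty term makes a DNF true everywhere; the empty DNF is false.\<close>
      by (rule exI[of _ "if e = c then [Map.empty] else []"]) (use e in \<open>auto simp: dnf_def\<close>)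
  qed
  show ?thesis
    using assms
  proof (induction k arbitrary: \<rho>)
    case 0
    then show ?case using const[of \<rho> 0] by simp
  next
    case (Suc k)
    show ?case
    proof (cases "forced N f \<rho>")
      case True
      then show ?thesis by (rule const)
    next
      case False
      then obtain v where v: "v \<in> N - dom \<rho>" "\<And>b. query_tree N k (forced N f) (\<rho>(v \<mapsto> b))"
        using Suc.prems by auto
      have "\<forall>b. \<exists>F. (\<forall>T\<in>set F. dom T \<subseteq> N - dom (\<rho>(v \<mapsto> b)) \<and> card (dom T) \<le> k)
          \<and> (\<forall>\<sigma>. \<rho>(v \<mapsto> b) \<subseteq>\<^sub>m \<sigma> \<longrightarrow> dom \<sigma> = N \<longrightarrow> (f \<sigma> = c) = dnf F \<sigma>)"
        by (intro allI Suc.IH v(2))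
      from choice[OF this] obtain G where G': "\<forall>b. (\<forall>T\<in>set (G b). dom T \<subseteq> N - dom (\<rho>(v \<mapsto> b)) \<and> card (dom T) \<le> k)
          \<and> (\<forall>\<sigma>. \<rho>(v \<mapsto> b) \<subseteq>\<^sub>m \<sigma> \<longrightarrow> dom \<sigma> = N \<longrightarrow> (f \<sigma> = c) = dnf (G b) \<sigma>)"
        by (elim exE)
      then have G: "\<And>b T. T \<in> set (G b) \<Longrightarrow> dom T \<subseteq> N - dom (\<rho>(v \<mapsto> b)) \<and> card (dom T) \<le> k"
        "\<And>b \<sigma>. \<rho>(v \<mapsto> b) \<subseteq>\<^sub>m \<sigma> \<Longrightarrow> dom \<sigma> = N \<Longrightarrow> (f \<sigma> = c) = dnf (G b) \<sigma>"
        by simp_all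
      have vT: "v \<notin> dom T" if "T \<in> set (G b)" for T b
        using G(1)[OF that] by auto
      define F where "F = map (\<lambda>T. T(v \<mapsto> False)) (G False) @ map (\<lambda>T. T(v \<mapsto> True)) (G True)"
      have mem: "T \<in> set F \<longleftrightarrow> (\<exists>b. \<exists>T'\<in>set (G b). T = T'(v \<mapsto> b))" for T
        by (auto simp: F_def ex_bool_eq)
      have "dom T \<subseteq> N - dom \<rho> \<and> card (dom T) \<le> Suc k" if "T \<in> set F" for T
      proof -
        from that[unfolded mem] obtain b where "\<exists>T'\<in>set (G b). T = T'(v \<mapsto> b)"
          by (rule exE)
        then obtain T' where T': "T' \<in> set (G b)" "T = T'(v \<mapsto> b)"
          by (rule bexE)
        have "dom T = insert v (dom T')" by (simp add: T'(2))
        then show ?thesis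
          using G(1)[OF T'(1)] v(1) card_insert_le_m1[of "Suc k" "dom T'" v] by auto
      qed
      moreover have "(f \<sigma> = c) = dnf F \<sigma>" if \<sigma>: "\<rho> \<subseteq>\<^sub>m \<sigma>" "dom \<sigma> = N" for \<sigma>
      proof -
        obtain b where b: "\<sigma> v = Some b"
          using v(1) \<sigma>(2) by blast
        have le: "\<rho>(v \<mapsto> b) \<subseteq>\<^sub>m \<sigma>"
          using \<sigma>(1) b by (auto simp: map_le_def)
        have iff: "T(v \<mapsto> b') \<subseteq>\<^sub>m \<sigma> \<longleftrightarrow> b' = b \<and> T \<subseteq>\<^sub>m \<sigma>" if "v \<notin> dom T" for T b'
          using that b by (auto simp: map_le_def domIff)
        have "dnf F \<sigma> \<longleftrightarrow> (\<exists>b'. \<exists>T\<in>set (G b'). T(v \<mapsto> b') \<subseteq>\<^sub>m \<sigma>)"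
          by (auto simp: dnf_def F_def ex_bool_eq)
        also have "\<dots> \<longleftrightarrow> (\<exists>b'. \<exists>T\<in>set (G b'). b' = b \<and> T \<subseteq>\<^sub>m \<sigma>)"
          by (intro arg_cong[of _ _ Ex] ext bex_cong refl iff vT)
        also have "\<dots> \<longleftrightarrow> dnf (G b) \<sigma>"
          by (simp add: dnf_def)
        finally show ?thesis
          using G(2)[OF le \<sigma>(2)] by simp
      qed
      ultimately show ?thesis by (intro exI[of _ F] conjI ballI allI impI) simp_all
    qed
  qed
qed

section \<open>Values and depths of the gates of a circuit\<close>

definition gate_vals :: "(nat \<Rightarrow> bool) \<Rightarrow> gate list \<Rightarrow> bool list" where
  "gate_vals x gs = foldl (\<lambda>vs g. vs @ [gate_val x vs g]) [] gs"

definition gate_depths :: "gate list \<Rightarrow> nat list" where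
  "gate_depths gs = foldl (\<lambda>ds g. ds @ [gate_depth ds g]) [] gs"

lemma gate_vals_snoc: "gate_vals x (gs @ [g]) = gate_vals x gs @ [gate_val x (gate_vals x gs) g]"
  by (simp add: gate_vals_def)

lemma gate_depths_snoc: "gate_depths (gs @ [g]) = gate_depths gs @ [gate_depth (gate_depths gs) g]"
  by (simp add: gate_depths_def)

lemma length_gate_vals [simp]: "length (gate_vals x gs) = length gs"
  by (induction gs rule: rev_induct) (simp_all add: gate_vals_snoc, simp add: gate_vals_def)

lemma length_gate_depths [simp]: "length (gate_depths gs) = length gs"
  by (induction gs rule: rev_induct) (simp_all add: gate_depths_snoc, simp add: gate_depths_def)

lemma wire_val_append: "wire_ok n (length vs) w \<Longrightarrow> wire_val x (vs @ us) w = wire_val x vs w"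
  by (cases w) (simp_all add: nth_append)

lemma wire_depth_append: "wire_ok n (length ds) w \<Longrightarrow> wire_depth (ds @ es) w = wire_depth ds w"
  by (cases w) (simp_all add: nth_append)

lemma gate_val_append:
  assumes "\<forall>w\<in>gate_wires g. wire_ok n (length vs) w"
  shows "gate_val x (vs @ us) g = gate_val x vs g"
  using assms wire_val_append[of n vs] by (cases g) auto

lemma gate_depth_append:
  assumes "\<forall>w\<in>gate_wires g. wire_ok n (length ds) w"
  shows "gate_depth (ds @ es) g = gate_depth ds g"
proof -
  have "wire_depth (ds @ es) ` set ws = wire_depth ds ` set ws" if "set ws \<subseteq> gate_wires g" for ws
    using that assms wire_depth_append[of n ds] by (intro image_cong) auto
  then show ?thesis
    using assms wire_depth_append[of n ds] by (cases g) auto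
qed

abbreviation wf_gates :: "nat \<Rightarrow> gate list \<Rightarrow> bool" where
  "wf_gates n gs \<equiv> \<forall>k < length gs. \<forall>w \<in> gate_wires (gs ! k). wire_ok n k w"

lemma wf_gates_snoc:
  assumes "wf_gates n (gs @ [g])"
  shows "wf_gates n gs" "\<forall>w\<in>gate_wires g. wire_ok n (length gs) w"
proof -
  show "wf_gates n gs"
  proof (intro allI impI)
    fix k assume "k < length gs"
    then show "\<forall>w\<in>gate_wires (gs ! k). wire_ok n k w"
      using spec[OF assms, of k] by (simp add: nth_append)
  qed
  show "\<forall>w\<in>gate_wires g. wire_ok n (length gs) w"
    using spec[OF assms, of "length gs"] by simp
qed

lemma wire_ok_mono: "wire_ok n k w \<Longrightarrow> k \<le> k' \<Longrightarrow> wire_ok n k' w"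
  by (cases w) auto

text \<open>Wires point to earlier positions only, so the prefix seen by the fold and the complete
  list of values give a gate the same output. This replaces the fold by local equations.\<close>

lemma gate_vals_nth:
  assumes "wf_gates n gs" "k < length gs"
  shows "gate_vals x gs ! k = gate_val x (gate_vals x gs) (gs ! k)"
  using assms
proof (induction gs rule: rev_induct)
  case (snoc g gs)
  note wf = wf_gates_snoc[OF snoc.prems(1)]
  show ?case
  proof (cases "k < length gs")
    case True
    have "\<forall>w\<in>gate_wires (gs ! k). wire_ok n (length (gate_vals x gs)) w"
      using wf(1) True wire_ok_mono[of n k _ "length gs"] by simp
    then show ?thesis
      using True snoc.IH[OF wf(1)] gate_val_append[of "gs ! k" n "gate_vals x gs"]
      by (simp add: gate_vals_snoc nth_append)
  next
    case False
    then have "k = length gs" using snoc.prems(2) by simp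
    then show ?thesis
      using wf(2) gate_val_append[of g n "gate_vals x gs"] by (simp add: gate_vals_snoc nth_append)
  qed
qed simp

lemma gate_depths_nth:
  assumes "wf_gates n gs" "k < length gs"
  shows "gate_depths gs ! k = gate_depth (gate_depths gs) (gs ! k)"
  using assms
proof (induction gs rule: rev_induct)
  case (snoc g gs)
  note wf = wf_gates_snoc[OF snoc.prems(1)]
  show ?case
  proof (cases "k < length gs")
    case True
    have "\<forall>w\<in>gate_wires (gs ! k). wire_ok n (length (gate_depths gs)) w"
      using wf(1) True wire_ok_mono[of n k _ "length gs"] by simp
    then show ?thesis
      using True snoc.IH[OF wf(1)] gate_depth_append[of "gs ! k" n "gate_depths gs"]
      by (simp add: gate_depths_snoc nth_append)
  next
    case False
    then have "k = length gs" using snoc.prems(2) by simp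
    then show ?thesis
      using wf(2) gate_depth_append[of g n "gate_depths gs"] by (simp add: gate_depths_snoc nth_append)
  qed
qed simp

text \<open>Free variables are read as False, in accordance with the padding in \<open>cube\<close>:
  an assignment with domain \<open>{..<n}\<close> becomes a point of \<open>cube n\<close>.\<close>

definition point :: "(nat \<rightharpoonup> bool) \<Rightarrow> nat \<Rightarrow> bool" where
  "point \<sigma> v \<longleftrightarrow> \<sigma> v = Some True"

definition wire_fun :: "gate list \<Rightarrow> wire \<Rightarrow> (nat \<rightharpoonup> bool) \<Rightarrow> bool" where
  "wire_fun gs w \<sigma> = wire_val (point \<sigma>) (gate_vals (point \<sigma>) gs) w"

lemma wire_fun_Input: "wire_fun gs (Input v) \<sigma> \<longleftrightarrow> \<sigma> v = Some True"
  by (simp add: wire_fun_def point_def)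

lemma wire_fun_Gate:
  assumes "wf_gates n gs" "j < length gs"
  shows "gs ! j = AndG ws \<Longrightarrow> wire_fun gs (Gate j) \<sigma> \<longleftrightarrow> (\<forall>w\<in>set ws. wire_fun gs w \<sigma>)"
    and "gs ! j = OrG ws \<Longrightarrow> wire_fun gs (Gate j) \<sigma> \<longleftrightarrow> (\<exists>w\<in>set ws. wire_fun gs w \<sigma>)"
    and "gs ! j = NotG w \<Longrightarrow> wire_fun gs (Gate j) \<sigma> \<longleftrightarrow> \<not> wire_fun gs w \<sigma>"
  using gate_vals_nth[OF assms, of "point \<sigma>"] by (simp_all add: wire_fun_def)

lemma forced_Not: "forced N (\<lambda>\<sigma>. \<not> f \<sigma>) \<rho> = forced N f \<rho>"
  unfolding forced_def by (metis (full_types))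

text \<open>A wire of depth 0 is an input behind a chain of NOT gates, since even an AND or OR gate
  without inputs has depth 1. One query decides it.\<close>

lemma wire_depth0_query_tree:
  assumes "wf_gates n gs"
    and "wire_ok n (length gs) w" "wire_depth (gate_depths gs) w = 0" "1 \<le> k"
  shows "query_tree {..<n} k (forced {..<n} (wire_fun gs w)) \<rho>"
proof -
  have input: "query_tree {..<n} 1 (forced {..<n} (wire_fun gs (Input v))) \<rho>" if "v < n" for v
  proof -
    have dom: "forced {..<n} (wire_fun gs (Input v)) \<rho>'" if "v \<in> dom \<rho>'" for \<rho>'
      unfolding forced_def
    proof (intro exI allI impI)
      fix \<sigma> assume "\<rho>' \<subseteq>\<^sub>m \<sigma>"
      then have "\<sigma> v = \<rho>' v" using that by (auto simp: map_le_def)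
      then show "wire_fun gs (Input v) \<sigma> = (\<rho>' v = Some True)"
        by (simp add: wire_fun_Input)
    qed
    show ?thesis
    proof (cases "v \<in> dom \<rho>")
      case True
      then show ?thesis by (intro query_tree_leaf[of "forced _ _"] dom)
    next
      case False
      have "query_tree {..<n} 0 (forced {..<n} (wire_fun gs (Input v))) (\<rho>(v \<mapsto> b))" for b
        unfolding query_tree.simps by (rule dom) simp
      then have "query_tree {..<n} (Suc 0) (forced {..<n} (wire_fun gs (Input v))) \<rho>"
        unfolding query_tree.simps(2) using False \<open>v < n\<close> by blast
      then show ?thesis by simp
    qed
  qed
  have gate: "query_tree {..<n} 1 (forced {..<n} (wire_fun gs (Gate j))) \<rho>"
    if "j < length gs" "gate_depths gs ! j = 0" for j
    using that
  proof (induction j rule: less_induct)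
    case (less j)
    show ?case
    proof (cases "gs ! j")
      case (NotG w)
      have "wire_ok n j w"
        using assms(1) less.prems(1) NotG by force
      moreover have "wire_depth (gate_depths gs) w = 0"
        using gate_depths_nth[OF assms(1) less.prems(1)] less.prems(2) NotG by simp
      ultimately have "query_tree {..<n} 1 (forced {..<n} (wire_fun gs w)) \<rho>"
        using less.IH less.prems(1) input by (cases w) auto
      moreover have "forced {..<n} (wire_fun gs (Gate j)) = forced {..<n} (wire_fun gs w)"
      proof -
        have eq: "wire_fun gs (Gate j) = (\<lambda>\<sigma>. \<not> wire_fun gs w \<sigma>)"
          using wire_fun_Gate(3)[OF assms(1) less.prems(1) NotG] by (simp add: fun_eq_iff)
        show ?thesis
          unfolding eq by (rule ext) (rule forced_Not)
      qed
      ultimately show ?thesis by simp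
    qed (use gate_depths_nth[OF assms(1) less.prems(1)] less.prems(2) in simp_all)
  qed
  have "query_tree {..<n} 1 (forced {..<n} (wire_fun gs w)) \<rho>"
    using assms(2,3) input gate by (cases w) simp_all
  then show ?thesis
    using assms(4) by (rule query_tree_weaken)
qed

section \<open>Gates as DNFs over the decision trees of the level below\<close>

text \<open>The bit c lets F describe f or its negation. The notion thus covers CNFs as well and is
  closed under NOT; decision tree depth does not distinguish the two.\<close>

definition dnf_like :: "'v set \<Rightarrow> nat \<Rightarrow> (('v \<rightharpoonup> bool) \<Rightarrow> bool) \<Rightarrow> ('v \<rightharpoonup> bool) \<Rightarrow> bool" where
  "dnf_like N k f \<rho> \<longleftrightarrow> (\<exists>F c. (\<forall>T\<in>set F. dom T \<subseteq> N \<and> card (dom T) \<le> k)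
     \<and> (\<forall>\<sigma>. \<rho> \<subseteq>\<^sub>m \<sigma> \<longrightarrow> dom \<sigma> = N \<longrightarrow> (f \<sigma> = c) = dnf F \<sigma>))"

lemma dnf_like_Not: "dnf_like N k f \<rho> \<Longrightarrow> dnf_like N k (\<lambda>\<sigma>. \<not> f \<sigma>) \<rho>"
proof -
  assume "dnf_like N k f \<rho>"
  then obtain F c where "\<forall>T\<in>set F. dom T \<subseteq> N \<and> card (dom T) \<le> k"
    "\<forall>\<sigma>. \<rho> \<subseteq>\<^sub>m \<sigma> \<longrightarrow> dom \<sigma> = N \<longrightarrow> (f \<sigma> = c) = dnf F \<sigma>"
    unfolding dnf_like_def by blast
  then show ?thesis
    unfolding dnf_like_def by (intro exI[of _ F] exI[of _ "\<not> c"]) auto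
qed

text \<open>Concatenating the DNFs of the inputs keeps the width k whatever the fan-in. OR gates use
  c = True, AND gates c = False and De Morgan.\<close>

lemma dnf_like_Bex:
  assumes "\<And>w. w \<in> set ws \<Longrightarrow> query_tree N k (forced N (f w)) \<rho>"
  shows "dnf_like N k (\<lambda>\<sigma>. \<exists>w\<in>set ws. f w \<sigma> = c) \<rho>"
proof -
  have "\<forall>w\<in>set ws. \<exists>F. (\<forall>T\<in>set F. dom T \<subseteq> N - dom \<rho> \<and> card (dom T) \<le> k)
      \<and> (\<forall>\<sigma>. \<rho> \<subseteq>\<^sub>m \<sigma> \<longrightarrow> dom \<sigma> = N \<longrightarrow> (f w \<sigma> = c) = dnf F \<sigma>)"
    by (intro ballI query_tree_imp_dnf assms)
  from bchoice[OF this] obtain F where "\<forall>w\<in>set ws. (\<forall>T\<in>set (F w). dom T \<subseteq> N - dom \<rho> \<and> card (dom T) \<le> k)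
      \<and> (\<forall>\<sigma>. \<rho> \<subseteq>\<^sub>m \<sigma> \<longrightarrow> dom \<sigma> = N \<longrightarrow> (f w \<sigma> = c) = dnf (F w) \<sigma>)"
    by (elim exE)
  then have F: "\<And>w T. w \<in> set ws \<Longrightarrow> T \<in> set (F w) \<Longrightarrow> dom T \<subseteq> N - dom \<rho> \<and> card (dom T) \<le> k"
    "\<And>w \<sigma>. w \<in> set ws \<Longrightarrow> \<rho> \<subseteq>\<^sub>m \<sigma> \<Longrightarrow> dom \<sigma> = N \<Longrightarrow> (f w \<sigma> = c) = dnf (F w) \<sigma>"
    by simp_all
  show ?thesis
    unfolding dnf_like_def
  proof (intro exI[of _ "concat (map F ws)"] exI[of _ True] conjI ballI allI impI)
    fix T assume "T \<in> set (concat (map F ws))"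
    then show "dom T \<subseteq> N" "card (dom T) \<le> k" using F(1) by fastforce+
  next
    fix \<sigma> assume "\<rho> \<subseteq>\<^sub>m \<sigma>" "dom \<sigma> = N"
    then show "((\<exists>w\<in>set ws. f w \<sigma> = c) = True) = dnf (concat (map F ws)) \<sigma>"
      using F(2) by (auto simp: dnf_def)
  qed
qed

text \<open>NOT gates do not raise the depth, so a wire of depth i + 1 may sit behind several of
  them; hence the induction over positions in the circuit.\<close>

lemma gate_dnf_like:
  assumes wf: "wf_gates n gs"
    and low: "\<And>w. wire_ok n (length gs) w \<Longrightarrow> wire_depth (gate_depths gs) w \<le> i \<Longrightarrow>
      query_tree {..<n} k (forced {..<n} (wire_fun gs w)) \<rho>"
    and "wire_ok n (length gs) w" "wire_depth (gate_depths gs) w \<le> Suc i"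
  shows "dnf_like {..<n} k (wire_fun gs w) \<rho>"
proof -
  have single: "dnf_like {..<n} k (wire_fun gs w) \<rho>"
    if "wire_ok n (length gs) w" "wire_depth (gate_depths gs) w \<le> i" for w
    using dnf_like_Bex[of "[w]" "{..<n}" k "wire_fun gs" \<rho> True] low[OF that] by simp
  have gate: "dnf_like {..<n} k (wire_fun gs (Gate j)) \<rho>"
    if "j < length gs" "gate_depths gs ! j \<le> Suc i" for j
    using that
  proof (induction j rule: less_induct)
    case (less j)
    have ok: "wire_ok n j w" if "w \<in> gate_wires (gs ! j)" for w
      using wf less.prems(1) that by blast
    have ok': "wire_ok n (length gs) w" if "w \<in> gate_wires (gs ! j)" for w
      using ok[OF that] less.prems(1) by (auto intro: wire_ok_mono)
    have depth: "gate_depth (gate_depths gs) (gs ! j) \<le> Suc i"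
      using gate_depths_nth[OF wf less.prems(1)] less.prems(2) by simp
    show ?case
    proof (cases "gs ! j")
      case (AndG ws)
      have "query_tree {..<n} k (forced {..<n} (wire_fun gs w)) \<rho>" if "w \<in> set ws" for w
      proof (rule low)
        show "wire_ok n (length gs) w" using that AndG by (intro ok') simp
        show "wire_depth (gate_depths gs) w \<le> i" using that AndG depth by simp
      qed
      then have "dnf_like {..<n} k (\<lambda>\<sigma>. \<not> (\<exists>w\<in>set ws. wire_fun gs w \<sigma> = False)) \<rho>"
        by (intro dnf_like_Not dnf_like_Bex)
      moreover have "(\<lambda>\<sigma>. \<not> (\<exists>w\<in>set ws. wire_fun gs w \<sigma> = False)) = wire_fun gs (Gate j)"
        using wire_fun_Gate(1)[OF wf less.prems(1) AndG] by (simp add: fun_eq_iff)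
      ultimately show ?thesis by simp
    next
      case (OrG ws)
      have "query_tree {..<n} k (forced {..<n} (wire_fun gs w)) \<rho>" if "w \<in> set ws" for w
      proof (rule low)
        show "wire_ok n (length gs) w" using that OrG by (intro ok') simp
        show "wire_depth (gate_depths gs) w \<le> i" using that OrG depth by simp
      qed
      then have "dnf_like {..<n} k (\<lambda>\<sigma>. \<exists>w\<in>set ws. wire_fun gs w \<sigma> = True) \<rho>"
        by (rule dnf_like_Bex)
      moreover have "(\<lambda>\<sigma>. \<exists>w\<in>set ws. wire_fun gs w \<sigma> = True) = wire_fun gs (Gate j)"
        using wire_fun_Gate(2)[OF wf less.prems(1) OrG] by (simp add: fun_eq_iff)
      ultimately show ?thesis by simp
    next
      case (NotG w)
      have w: "w \<in> gate_wires (gs ! j)" by (simp add: NotG)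
      have "dnf_like {..<n} k (wire_fun gs w) \<rho>"
      proof (cases w)
        case (Input v)
        then show ?thesis using single[OF ok'[OF w]] by simp
      next
        case (Gate j')
        then show ?thesis
          using less.IH[of j'] ok[OF w] less.prems(1) depth NotG by simp
      qed
      then have "dnf_like {..<n} k (\<lambda>\<sigma>. \<not> wire_fun gs w \<sigma>) \<rho>"
        by (rule dnf_like_Not)
      moreover have "(\<lambda>\<sigma>. \<not> wire_fun gs w \<sigma>) = wire_fun gs (Gate j)"
        using wire_fun_Gate(3)[OF wf less.prems(1) NotG] by (simp add: fun_eq_iff)
      ultimately show ?thesis by simp
    qed
  qed
  show ?thesis
    using assms(3,4) single[of w] gate by (cases w) simp_all
qed

text \<open>The choice z = 4, q = 1/4, y = 1/(2k). The constant 512 is tight once 1 - p is replaced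
  by 1/2: both sides of the second inequality then equal 1/(16k).\<close>

lemma switching_params:
  fixes k :: nat
  assumes "1 \<le> k"
  shows "(1 + 1 / (2 * real k)) ^ k \<le> 2"
    and "8 * (1 / (512 * real k)) * 4 \<le> (1 - 1 / (512 * real k)) * (1 / 4 * (1 / (2 * real k)))"
proof -
  have "(1 + 1 / (2 * real k)) ^ k \<le> exp (1 / (2 * real k)) ^ k"
    by (intro power_mono exp_ge_add_one_self) simp
  also have "\<dots> = exp (1 / 2)"
    using assms by (simp add: exp_of_nat_mult[symmetric])
  also have "\<dots> \<le> 2"
    by (rule exp_half_le2)
  finally show "(1 + 1 / (2 * real k)) ^ k \<le> 2" .
  have "1 / 2 * (1 / 4 * (1 / (2 * real k))) \<le> (1 - 1 / (512 * real k)) * (1 / 4 * (1 / (2 * real k)))"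
    using assms by (intro mult_right_mono) (auto simp: field_simps)
  then show "8 * (1 / (512 * real k)) * 4 \<le> (1 - 1 / (512 * real k)) * (1 / 4 * (1 / (2 * real k)))"
    by simp
qed

text \<open>This is \<open>multi_switching\<close> with B = 3/2 and constant weight; its condition
  on B becomes 3 * card J \<le> 4 ^ Suc r. Trees for the DNFs are trees for the g j, because every
  node examined extends \<rho>, where the two agree up to negation.\<close>

lemma switching_family:
  fixes g :: "'i \<Rightarrow> ('v \<rightharpoonup> bool) \<Rightarrow> bool"
  assumes N: "finite N" and dom: "dom \<rho> \<subseteq> N" and J: "finite J" and k: "1 \<le> k"
    and g: "\<And>j. j \<in> J \<Longrightarrow> dnf_like N k (g j) \<rho>"
    and m: "3 * card J \<le> 4 ^ Suc r"
  shows "rsum (restr_weight (1 / (512 * real k))) (N - dom \<rho>)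
    (\<lambda>\<sigma>. 4 ^ query_depth N (\<lambda>\<rho>. \<forall>j\<in>J. query_tree N r (forced N (g j)) \<rho>) (\<sigma> ++ \<rho>)) \<le> 3 / 2"
proof -
  have "\<forall>j\<in>J. \<exists>F c. (\<forall>T\<in>set F. dom T \<subseteq> N \<and> card (dom T) \<le> k)
      \<and> (\<forall>\<sigma>. \<rho> \<subseteq>\<^sub>m \<sigma> \<longrightarrow> dom \<sigma> = N \<longrightarrow> (g j \<sigma> = c) = dnf F \<sigma>)"
    using g unfolding dnf_like_def by (rule ballI)
  from bchoice[OF this] obtain F where "\<forall>j\<in>J. \<exists>c. (\<forall>T\<in>set (F j). dom T \<subseteq> N \<and> card (dom T) \<le> k)
      \<and> (\<forall>\<sigma>. \<rho> \<subseteq>\<^sub>m \<sigma> \<longrightarrow> dom \<sigma> = N \<longrightarrow> (g j \<sigma> = c) = dnf (F j) \<sigma>)"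
    by (elim exE)
  from bchoice[OF this] obtain c where Fc: "\<forall>j\<in>J. (\<forall>T\<in>set (F j). dom T \<subseteq> N \<and> card (dom T) \<le> k)
      \<and> (\<forall>\<sigma>. \<rho> \<subseteq>\<^sub>m \<sigma> \<longrightarrow> dom \<sigma> = N \<longrightarrow> (g j \<sigma> = c j) = dnf (F j) \<sigma>)"
    by (elim exE)
  have F: "\<And>j T. j \<in> J \<Longrightarrow> T \<in> set (F j) \<Longrightarrow> dom T \<subseteq> N \<and> card (dom T) \<le> k"
    and eq: "\<And>j \<sigma>. j \<in> J \<Longrightarrow> \<rho> \<subseteq>\<^sub>m \<sigma> \<Longrightarrow> dom \<sigma> = N \<Longrightarrow> (g j \<sigma> = c j) = dnf (F j) \<sigma>"
    using Fc by simp_all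
  let ?p = "1 / (512 * real k)"
  let ?P = "\<lambda>\<rho>. \<forall>j\<in>J. query_tree N r (forced N (g j)) \<rho>"
  let ?P' = "\<lambda>\<rho>. \<forall>j\<in>J. query_tree N r (forced N (dnf (F j))) \<rho>"
  have p: "0 < ?p" "?p < 1" using k by (simp_all add: divide_less_eq)
  have P'tot: "?P' \<sigma>" if "dom \<sigma> = N" for \<sigma>
    using total_query_tree[OF that] by blast
  have "rsum (restr_weight ?p) (N - dom \<rho>) (\<lambda>\<sigma>. 4 ^ query_depth N ?P (\<sigma> ++ \<rho>))
    \<le> rsum (restr_weight ?p) (N - dom \<rho>) (\<lambda>\<sigma>. 4 ^ query_depth N ?P' (\<sigma> ++ \<rho>) * 1)"
  proof (intro rsum_mono restr_weight_nonneg)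
    fix \<sigma> :: "'v \<rightharpoonup> bool" assume \<sigma>: "dom \<sigma> \<subseteq> N - dom \<rho>"
    have "query_depth N ?P (\<sigma> ++ \<rho>) \<le> query_depth N ?P' (\<sigma> ++ \<rho>)"
    proof (rule query_depth_antimono[OF N])
      show "dom (\<sigma> ++ \<rho>) \<subseteq> N" using \<sigma> dom by auto
    next
      fix \<rho>' assume \<rho>': "\<sigma> ++ \<rho> \<subseteq>\<^sub>m \<rho>'" "?P' \<rho>'"
      show "?P \<rho>'"
      proof
        fix j assume j: "j \<in> J"
        then have "query_tree N r (forced N (dnf (F j))) \<rho>'" using \<rho>'(2) by blast
        then show "query_tree N r (forced N (g j)) \<rho>'"
        proof (rule query_tree_mono[OF _ le_refl])
          fix \<rho>'' assume "\<rho>' \<subseteq>\<^sub>m \<rho>''" "forced N (dnf (F j)) \<rho>''"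
          then obtain e where e: "\<And>\<sigma>. \<rho>'' \<subseteq>\<^sub>m \<sigma> \<Longrightarrow> dom \<sigma> = N \<Longrightarrow> dnf (F j) \<sigma> = e"
            unfolding forced_def by blast
          have le: "\<rho> \<subseteq>\<^sub>m \<rho>''"
            using map_le_trans[OF map_le_trans[OF map_le_map_add \<rho>'(1)] \<open>\<rho>' \<subseteq>\<^sub>m \<rho>''\<close>] .
          show "forced N (g j) \<rho>''"
            unfolding forced_def
          proof (intro exI allI impI)
            fix \<tau> assume \<tau>: "\<rho>'' \<subseteq>\<^sub>m \<tau>" "dom \<tau> = N"
            show "g j \<tau> = (c j = e)"
              using eq[OF j map_le_trans[OF le \<tau>(1)] \<tau>(2)] e[OF \<tau>] by auto
          qed
        qed
      qed
    qed (rule P'tot)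
    then show "4 ^ query_depth N ?P (\<sigma> ++ \<rho>) \<le> (4 :: real) ^ query_depth N ?P' (\<sigma> ++ \<rho>) * 1"
      by simp
  qed (use p in auto)
  also have "\<dots> \<le> 3 / 2 * rsum (restr_weight ?p) (N - dom \<rho>) (\<lambda>_. 1)"
  proof (rule multi_switching[OF N J p, where q = "1 / 4" and y = "1 / (2 * real k)" and k = k])
    have "3 * real (card J) \<le> 4 ^ Suc r"
      using of_nat_mono[OF m, where ?'a = real] by simp
    then show "real (card J) * (1 / 4) ^ Suc r * (3 / 2) \<le> 3 / 2 - (1 :: real)"
      by (simp add: power_one_over field_simps)
    show "dom \<rho> = N - (N - dom \<rho>)" using dom by blast
  qed (use switching_params[OF k] F in \<open>auto simp: mono_weight_def\<close>)
  also have "rsum (restr_weight ?p) (N - dom \<rho>) (\<lambda>_. 1 :: real) = 1"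
    using N by (intro rsum_const restr_weight_total) simp
  finally show ?thesis by simp
qed

text \<open>The invariant P i gives shallow trees to all gates of depth at most i, so a gate of the
  next level may read any of them. After the first restriction, d - 2 steps reach P (d - 1), and a
  last one treats the output.\<close>

lemma circuit_restriction:
  assumes f: "f \<in> circuit_class n S d" and d: "2 \<le> d" and S: "1 \<le> S" "3 * S \<le> 4 ^ Suc r"
  shows "rsum (restr_weight (1 / 512 * (1 / (512 * real (Suc r))) ^ (d - 1))) {..<n}
    (\<lambda>\<rho>. 4 ^ query_depth {..<n} (forced {..<n} (\<lambda>\<sigma>. f (point \<sigma>))) \<rho>) \<le> 2"
proof -
  obtain gs out where wf: "wf_gates n gs" and out: "wire_ok n (length gs) out"
    and len: "length gs \<le> S" and depth: "wire_depth (gate_depths gs) out \<le> d"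
    and val: "\<And>x. x \<in> cube n \<Longrightarrow> f x = circuit_val gs out x"
    using f unfolding circuit_class_def wf_circuit_def circuit_depth_def gate_depths_def by blast
  let ?N = "{..<n}"
  let ?p = "1 / (512 * real (Suc r))"
  define J where "J = (\<lambda>i. {j. j < length gs \<and> gate_depths gs ! j \<le> i})"
  define P where "P = (\<lambda>i \<rho>. \<forall>j\<in>J i. query_tree ?N r (forced ?N (wire_fun gs (Gate j))) \<rho>)"
  have Ptot: "P i \<sigma>" if "dom \<sigma> = ?N" for i \<sigma>
    unfolding P_def using total_query_tree[OF that] by blast
  have J: "finite (J i)" "3 * card (J i) \<le> 4 ^ Suc r" for i
  proof -
    have sub: "J i \<subseteq> {..<length gs}" by (auto simp: J_def)
    then show "finite (J i)" by (rule finite_subset) simp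
    have "card (J i) \<le> length gs"
      using card_mono[OF _ sub] by simp
    then show "3 * card (J i) \<le> 4 ^ Suc r"
      using S len by linarith
  qed
  have p: "0 \<le> ?p" "?p \<le> 3 / 32" by (auto simp: field_simps)
  \<comment> \<open>\<open>Suc r\<close> instead of \<open>r\<close> because an input wire needs one
    query even if r = 0.\<close>
  have low: "query_tree ?N (Suc r) (forced ?N (wire_fun gs w)) \<rho>"
    if "P i \<rho>" "wire_ok n (length gs) w" "wire_depth (gate_depths gs) w \<le> i" for i \<rho> w
  proof (cases w)
    case (Input v)
    then show ?thesis
      using that(2) by (intro wire_depth0_query_tree[OF wf]) auto
  next
    case (Gate j)
    then have "query_tree ?N r (forced ?N (wire_fun gs w)) \<rho>"
      using that unfolding P_def J_def by simp
    then show ?thesis by (rule query_tree_weaken) simp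
  qed
  \<comment> \<open>The gates of depth 1 have unbounded fan-in but are 1-DNFs up to negation, so a constant
    star probability suffices for them; this is why the exponent is \<open>d - 1\<close> and not \<open>d\<close>.\<close>
  have level: "rsum (restr_weight (1 / 512 * ?p ^ i)) ?N (\<lambda>\<rho>. 4 ^ query_depth ?N (P (Suc i)) \<rho>) \<le> 2" for i
  proof (induction i)
    case 0
    have "dnf_like ?N 1 (wire_fun gs (Gate j)) Map.empty" if "j \<in> J (Suc 0)" for j
    proof (rule gate_dnf_like[OF wf, where i = 0])
      show "query_tree ?N 1 (forced ?N (wire_fun gs w)) Map.empty"
        if "wire_ok n (length gs) w" "wire_depth (gate_depths gs) w \<le> 0" for w
        using that by (intro wire_depth0_query_tree[OF wf]) auto
    qed (use that in \<open>auto simp: J_def\<close>)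
    from switching_family[OF finite_lessThan _ J(1) le_refl this J(2)]
    have "rsum (restr_weight (1 / 512)) ?N (\<lambda>\<rho>. 4 ^ query_depth ?N (P (Suc 0)) \<rho>) \<le> 3 / 2"
      unfolding P_def by simp
    then show ?case by simp
  next
    case (Suc i)
    have "rsum (restr_weight (1 / 512 * ?p ^ i * ?p)) ?N (\<lambda>\<rho>. 4 ^ query_depth ?N (P (Suc (Suc i))) \<rho>) \<le> 2"
    proof (rule restrict_step[where P = "P (Suc i)" and P' = "P (Suc (Suc i))", OF _ Ptot Ptot _ _ p _ Suc.IH])
      have "?p ^ i \<le> 1" using p by (intro power_le_one) auto
      then show "1 / 512 * ?p ^ i \<le> 1" by simp
      show "rsum (restr_weight ?p) (?N - dom \<rho>) (\<lambda>\<sigma>. 4 ^ query_depth ?N (P (Suc (Suc i))) (\<sigma> ++ \<rho>)) \<le> 3 / 2"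
        if "dom \<rho> \<subseteq> ?N" "P (Suc i) \<rho>" for \<rho>
        unfolding P_def
      proof (rule switching_family[OF finite_lessThan that(1) J(1) _ _ J(2)])
        fix j assume "j \<in> J (Suc (Suc i))"
        then show "dnf_like ?N (Suc r) (wire_fun gs (Gate j)) \<rho>"
          by (intro gate_dnf_like[OF wf low[OF that(2)]]) (auto simp: J_def)
      qed simp
    qed (use p in auto)
    then show ?case by (simp only: power_Suc2 mult.assoc)
  qed
  define e where "e = d - 2"
  have e: "d = Suc (Suc e)" "d - 1 = Suc e" using d by (simp_all add: e_def)
  have "rsum (restr_weight (1 / 512 * ?p ^ e * ?p)) ?N (\<lambda>\<rho>. 4 ^ query_depth ?N (forced ?N (wire_fun gs out)) \<rho>) \<le> 2"
  proof (rule restrict_step[where P = "P (Suc e)" and P' = "forced ?N (wire_fun gs out)", OF _ Ptot forced_total _ _ p _ level])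
    have "?p ^ e \<le> 1" using p by (intro power_le_one) auto
    then show "1 / 512 * ?p ^ e \<le> 1" by simp
    show "rsum (restr_weight ?p) (?N - dom \<rho>) (\<lambda>\<sigma>. 4 ^ query_depth ?N (forced ?N (wire_fun gs out)) (\<sigma> ++ \<rho>)) \<le> 3 / 2"
      if "dom \<rho> \<subseteq> ?N" "P (Suc e) \<rho>" for \<rho>
    proof -
      have "dnf_like ?N (Suc r) (wire_fun gs out) \<rho>"
      proof (rule gate_dnf_like[OF wf low[OF that(2)] out])
        show "wire_depth (gate_depths gs) out \<le> Suc (Suc e)"
          using depth e(1) by simp
      qed
      \<comment> \<open>A family of one member with r = 0: a tree of depth 0 means that the output
        is forced, so the common tree becomes a decision tree for the output. The size condition
        reads 3 \<le> 4.\<close>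
      then show ?thesis
        using switching_family[OF finite_lessThan that(1), of "{()}" "Suc r" "\<lambda>_. wire_fun gs out" 0]
        by simp
    qed
  qed (use p in auto)
  moreover have "query_depth ?N (forced ?N (\<lambda>\<sigma>. f (point \<sigma>))) \<rho> = query_depth ?N (forced ?N (wire_fun gs out)) \<rho>" for \<rho>
  proof -
    have "f (point \<sigma>) = wire_fun gs out \<sigma>" if "dom \<sigma> = ?N" for \<sigma>
    proof -
      have "point \<sigma> \<in> cube n"
        unfolding cube_def point_def
      proof (intro CollectI allI impI notI)
        fix i assume "n \<le> i" "\<sigma> i = Some True"
        then have "i \<in> dom \<sigma>" by blast
        then show False using that \<open>n \<le> i\<close> by simp
      qed
      then show ?thesis
        by (simp add: val circuit_val_def wire_fun_def gate_vals_def)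
    qed
    then have "forced ?N (\<lambda>\<sigma>. f (point \<sigma>)) = forced ?N (wire_fun gs out)"
      unfolding forced_def fun_eq_iff by metis
    then show ?thesis by simp
  qed
  ultimately show ?thesis
    by (simp only: e(2) power_Suc2 mult.assoc)
qed

section \<open>Pseudodensity of the biased distribution\<close>

lemma set_pmf_noise: "set_pmf (noise n \<alpha>) \<subseteq> cube n"
  unfolding noise_def cube_def using set_Pi_pmf_subset[of "{..<n}" False] by (auto simp: not_less[symmetric])

lemma finite_cube: "finite (cube n)"
proof -
  have "cube n \<subseteq> (\<lambda>S i. i \<in> S) ` Pow {..<n}"
  proof
    fix x assume x: "x \<in> cube n"
    show "x \<in> (\<lambda>S i. i \<in> S) ` Pow {..<n}"
      by (rule image_eqI[of _ _ "{i. x i}"]) (use x in \<open>auto simp: cube_def not_le[symmetric]\<close>)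
  qed
  then show ?thesis
    by (rule finite_subset) simp
qed

lemma expectation_cube:
  fixes h :: "(nat \<Rightarrow> bool) \<Rightarrow> real"
  assumes "set_pmf X \<subseteq> cube n"
  shows "measure_pmf.expectation X h = (\<Sum>x\<in>cube n. h x * pmf X x)"
  using assms finite_cube by (intro integral_measure_pmf_real) auto

lemma expectation_noise:
  fixes h :: "(nat \<Rightarrow> bool) \<Rightarrow> real"
  assumes "0 \<le> \<alpha>" "\<alpha> \<le> 1 / 2"
  shows "measure_pmf.expectation (noise n \<alpha>) h = rsum (bias_weight \<alpha>) {..<n} (\<lambda>\<sigma>. h (point \<sigma>))"
proof -
  have "measure_pmf.expectation (Pi_pmf V False (\<lambda>_. bernoulli_pmf (1/2 - \<alpha>))) h
      = rsum (bias_weight \<alpha>) V (\<lambda>\<sigma>. h (point \<sigma>))" if "finite V" for V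
    using that
  proof (induction V arbitrary: h)
    case empty
    have "point Map.empty = (\<lambda>_. False)"
      by (simp add: fun_eq_iff point_def)
    then show ?case by simp
  next
    case (insert v V)
    let ?M = "Pi_pmf V False (\<lambda>_. bernoulli_pmf (1/2 - \<alpha>))"
    have upd: "point (\<sigma>(v \<mapsto> b)) = (point \<sigma>)(v := b)" for \<sigma> b
      by (auto simp: fun_eq_iff point_def)
    have fin: "finite (set_pmf ?M)"
      using insert.hyps(1)
      by (intro finite_subset[OF set_Pi_pmf_subset'] finite_PiE_dflt) auto
    have "measure_pmf.expectation (Pi_pmf (insert v V) False (\<lambda>_. bernoulli_pmf (1/2 - \<alpha>))) h
      = measure_pmf.expectation (bernoulli_pmf (1/2 - \<alpha>) \<bind> (\<lambda>b. map_pmf (\<lambda>f. f(v := b)) ?M)) h"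
      using insert.hyps by (simp add: Pi_pmf_insert' map_pmf_def)
    also have "\<dots> = (\<Sum>b\<in>UNIV. pmf (bernoulli_pmf (1/2 - \<alpha>)) b *\<^sub>R measure_pmf.expectation (map_pmf (\<lambda>f. f(v := b)) ?M) h)"
      using fin by (intro pmf_expectation_bind) auto
    also have "\<dots> = (1/2 + \<alpha>) * measure_pmf.expectation ?M (\<lambda>f. h (f(v := False)))
      + (1/2 - \<alpha>) * measure_pmf.expectation ?M (\<lambda>f. h (f(v := True)))"
      using assms by (simp add: UNIV_bool)
    also have "\<dots> = rsum (bias_weight \<alpha>) (insert v V) (\<lambda>\<sigma>. h (point \<sigma>))"
      unfolding insert.IH rsum_insert[OF insert.hyps] upd by (simp add: bias_weight_def)
    finally show ?case .
  qed
  then show ?thesis by (simp add: noise_def)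
qed

lemma uniform_cube_eq_noise: "uniform_cube n = noise n 0"
proof -
  have "noise n 0 = Pi_pmf {..<n} False (\<lambda>_. pmf_of_set UNIV)"
    by (simp add: noise_def bernoulli_pmf_half_conv_pmf_of_set)
  also have "\<dots> = pmf_of_set (PiE_dflt {..<n} False (\<lambda>_. UNIV))"
    by (intro Pi_pmf_of_set) auto
  also have "PiE_dflt {..<n} False (\<lambda>_. UNIV) = cube n"
    by (auto simp: PiE_dflt_def cube_def)
  finally show ?thesis by (simp add: uniform_cube_def)
qed

text \<open>With \<beta> = \<alpha> / p, the first bound on \<alpha> gives \<beta> \<le> 1/2. The
  second gives exp (2 \<beta> M) \<le> 2 powr L = 1 / \<delta>, the loss allowed for trees shallower
  than M.\<close>

lemma pseudodense_noise:
  fixes M L :: real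
  assumes d: "2 \<le> d" and S: "1 \<le> S" "3 * S \<le> 4 ^ Suc r"
    and \<delta>: "\<delta> = 2 powr (- L)" "0 < L" and M: "0 < M" and \<alpha>: "0 \<le> \<alpha>"
    and p: "p = 1 / 512 * (1 / (512 * real (Suc r))) ^ (d - 1)" "2 * \<alpha> \<le> p" "2 * \<alpha> * M \<le> p * (L * ln 2)"
  shows "pseudodense n (circuit_class n S d) (2 powr (- M)) \<delta> (noise n \<alpha>)"
  unfolding pseudodense_def
proof
  fix f assume f: "f \<in> circuit_class n S d"
  have "(1 / (512 * real (Suc r))) ^ (d - 1) \<le> 1"
    by (intro power_le_one) (simp_all add: divide_le_eq)
  then have p01: "0 < p" "p \<le> 1"
    unfolding p(1) by simp_all
  define \<beta> where "\<beta> = \<alpha> / p"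
  have \<beta>: "0 \<le> \<beta>" "\<beta> \<le> 1 / 2" "p * \<beta> = \<alpha>"
    using p01 \<alpha> p(2) by (auto simp: \<beta>_def field_simps)
  have \<alpha>2: "\<alpha> \<le> 1 / 2" using p(2) p01 by simp
  have small: "\<delta> * (1 + 2 * \<beta>) ^ t \<le> 1" if "real t < M" for t
  proof -
    have "(1 + 2 * \<beta>) ^ t \<le> exp (2 * \<beta>) ^ t"
      using \<beta>(1) by (intro power_mono exp_ge_add_one_self) simp
    also have "\<dots> = exp (real t * (2 * \<beta>))"
      by (rule exp_of_nat_mult[symmetric])
    also have "\<dots> \<le> exp (M * (2 * \<beta>))"
      using that \<beta>(1) by (auto intro!: mult_right_mono)
    also have "\<dots> \<le> exp (L * ln 2)"
      using p(3) p01 by (simp add: \<beta>_def field_simps)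
    also have "\<dots> = 2 powr L"
      by (simp add: powr_def)
    finally have "\<delta> * (1 + 2 * \<beta>) ^ t \<le> \<delta> * 2 powr L"
      by (intro mult_left_mono) (simp_all add: \<delta>(1))
    also have "\<dots> = 1"
      by (simp add: \<delta>(1) powr_add[symmetric])
    finally show ?thesis .
  qed
  have "\<delta> * rsum (bias_weight (p * \<beta>)) {..<n} (\<lambda>\<sigma>. of_bool (f (point \<sigma>)))
    \<le> rsum (bias_weight 0) {..<n} (\<lambda>\<sigma>. of_bool (f (point \<sigma>))) + 2 powr (- M)"
  proof (rule bias_restricted_bound[OF _ p01 \<beta>(1,2) _ _ M small])
    show "rsum (restr_weight p) {..<n} (\<lambda>\<rho>. 4 ^ query_depth {..<n} (forced {..<n} (\<lambda>\<sigma>. f (point \<sigma>))) \<rho>) \<le> 2"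
      unfolding p(1) by (rule circuit_restriction[OF f d S])
    show "\<delta> \<le> 1"
      using \<delta>(2) powr_mono[of "- L" 0 2] by (simp add: \<delta>(1))
  qed (simp_all add: \<delta>(1))
  then show "\<delta> * expect (noise n \<alpha>) f \<le> expect (uniform_cube n) f + 2 powr (- M)"
    using \<alpha> \<alpha>2 by (simp add: uniform_cube_eq_noise expectation_noise \<beta>(3))
qed

text \<open>Disposes of the case in which log(1/\<open>\<epsilon>'\<close>) may be smaller than
  log(1/\<delta>), or not even positive.\<close>

lemma pseudodense_of_le:
  assumes "\<delta> \<le> \<epsilon>'" "0 \<le> \<delta>"
  shows "pseudodense n F \<epsilon>' \<delta> Z"
  unfolding pseudodense_def
proof
  fix f :: "(nat \<Rightarrow> bool) \<Rightarrow> bool"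
  have "expect Z f \<le> 1"
    by (intro measure_pmf.integral_le_const) (auto intro!: measure_pmf.integrable_const_bound[of _ 1])
  then have "\<delta> * expect Z f \<le> \<delta> * 1"
    using assms(2) by (rule mult_left_mono)
  moreover have "0 \<le> expect (uniform_cube n) f"
    by (intro Bochner_Integration.integral_nonneg) auto
  ultimately show "\<delta> * expect Z f \<le> expect (uniform_cube n) f + \<epsilon>'"
    using assms(1) by linarith
qed

section \<open>Failure of density\<close>

definition sign_sum :: "nat \<Rightarrow> (nat \<Rightarrow> bool) \<Rightarrow> real" where
  "sign_sum n x = (\<Sum>i<n. 1 - 2 * of_bool (x i))"

text \<open>Variance plus squared mean for a sum of n independent signs of mean 2 \<alpha>.\<close>

lemma expectation_sign_sum:
  assumes "0 \<le> \<alpha>" "\<alpha> \<le> 1 / 2"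
  shows "measure_pmf.expectation (noise n \<alpha>) (\<lambda>x. sign_sum n x ^ 2) = real n * (1 - 4 * \<alpha>\<^sup>2) + 4 * \<alpha>\<^sup>2 * (real n)\<^sup>2"
proof -
  let ?E = "\<lambda>n. rsum (bias_weight \<alpha>) {..<n}"
  let ?s = "\<lambda>n \<sigma>. sign_sum n (point \<sigma>)"
  have upd: "?s (Suc n) (\<sigma>(n \<mapsto> b)) = ?s n \<sigma> + (1 - 2 * of_bool b)" for n \<sigma> b
    by (simp add: sign_sum_def point_def)
  have un: "rsum (bias_weight \<alpha>) {..<Suc n} h
    = (1/2 + \<alpha>) * ?E n (\<lambda>\<sigma>. h (\<sigma>(n \<mapsto> False))) + (1/2 - \<alpha>) * ?E n (\<lambda>\<sigma>. h (\<sigma>(n \<mapsto> True)))" for n and h :: "(nat \<rightharpoonup> bool) \<Rightarrow> real"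
    using rsum_insert[of "{..<n}" n "bias_weight \<alpha>" h] by (simp add: lessThan_Suc bias_weight_def)
  have one: "?E n (\<lambda>\<sigma>. c) = c" for n :: nat and c
    by (intro rsum_const bias_weight_total) simp
  have m: "?E n (?s n) = 2 * \<alpha> * real n" for n
  proof (induction n)
    case 0
    then show ?case by (simp add: sign_sum_def)
  next
    case (Suc n)
    show ?case
      unfolding un upd rsum_add one Suc by (simp add: field_simps)
  qed
  have "?E n (\<lambda>\<sigma>. (?s n \<sigma>)\<^sup>2) = real n * (1 - 4 * \<alpha>\<^sup>2) + 4 * \<alpha>\<^sup>2 * (real n)\<^sup>2"
  proof (induction n)
    case 0
    then show ?case by (simp add: sign_sum_def)
  next
    case (Suc n)
    have sq: "?E n (\<lambda>\<sigma>. (?s n \<sigma> + c)\<^sup>2) = ?E n (\<lambda>\<sigma>. (?s n \<sigma>)\<^sup>2) + 2 * c * ?E n (?s n) + c\<^sup>2" for c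
    proof -
      have "(\<lambda>\<sigma>. (?s n \<sigma> + c)\<^sup>2) = (\<lambda>\<sigma>. (?s n \<sigma>)\<^sup>2 + (2 * c * ?s n \<sigma> + c\<^sup>2))"
        by (simp add: fun_eq_iff power2_sum algebra_simps)
      then show ?thesis by (simp only: rsum_add rsum_cmult one add.assoc)
    qed
    show ?case
      unfolding un upd sq m Suc by (simp add: field_simps power2_eq_square)
  qed
  then show ?thesis
    using assms by (simp add: expectation_noise)
qed

lemma clause_in_circuit_class:
  assumes "set vs \<subseteq> {..<n}" "1 \<le> S" "1 \<le> d"
  shows "(\<lambda>x. \<forall>v\<in>set vs. x v) \<in> circuit_class n S d" "(\<lambda>x. \<exists>v\<in>set vs. x v) \<in> circuit_class n S d"
proof -
  have depth: "Max (insert 0 (wire_depth [] ` Input ` set vs)) = 0"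
    by (subst Max_eq_iff) auto
  show "(\<lambda>x. \<forall>v\<in>set vs. x v) \<in> circuit_class n S d"
    unfolding circuit_class_def mem_Collect_eq
    by (rule exI[of _ "[AndG (map Input vs)]"], rule exI[of _ "Gate 0"])
      (use assms depth in \<open>auto simp: wf_circuit_def circuit_depth_def circuit_val_def\<close>)
  show "(\<lambda>x. \<exists>v\<in>set vs. x v) \<in> circuit_class n S d"
    unfolding circuit_class_def mem_Collect_eq
    by (rule exI[of _ "[OrG (map Input vs)]"], rule exI[of _ "Gate 0"])
      (use assms depth in \<open>auto simp: wf_circuit_def circuit_depth_def circuit_val_def\<close>)
qed

text \<open>The number of ordered triples on which \<open>x\<close> is constant; repeated indices are allowed, which
  makes it the sum of two perfect cubes.\<close>

definition count_cubes :: "nat \<Rightarrow> (nat \<Rightarrow> bool) \<Rightarrow> real" where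
  "count_cubes n x = (\<Sum>i<n. \<Sum>j<n. \<Sum>k<n.
     of_bool (\<forall>v\<in>set [i, j, k]. x v) + (1 - of_bool (\<exists>v\<in>set [i, j, k]. x v)))"

text \<open>With s the sign sum, the numbers of ones and zeros are (n - s)/2 and (n + s)/2; in the
  sum of their cubes the odd powers of s cancel.\<close>

lemma count_cubes_eq: "count_cubes n x = real n ^ 3 / 4 + 3 * real n / 4 * (sign_sum n x)\<^sup>2"
proof -
  define a where "a = (\<Sum>i<n. of_bool (x i) :: real)"
  have b: "(\<Sum>i<n. 1 - of_bool (x i)) = real n - a"
    by (simp add: sum_subtractf a_def)
  have cube: "(\<Sum>i<n. \<Sum>j<n. \<Sum>k<n. h i * h j * h k) = (\<Sum>i<n. h i) ^ 3" for h :: "nat \<Rightarrow> real"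
    by (simp only: power3_eq_cube sum_distrib_left[symmetric] sum_distrib_right[symmetric])
  have "count_cubes n x = (\<Sum>i<n. \<Sum>j<n. \<Sum>k<n. of_bool (x i) * of_bool (x j) * of_bool (x k)
      + (1 - of_bool (x i)) * (1 - of_bool (x j)) * (1 - of_bool (x k)))"
    unfolding count_cubes_def by (intro sum.cong refl) (auto simp: of_bool_def)
  also have "\<dots> = a ^ 3 + (real n - a) ^ 3"
    by (simp only: sum.distrib cube b a_def[symmetric])
  also have "\<dots> = real n ^ 3 / 4 + 3 * real n / 4 * (real n - 2 * a)\<^sup>2"
    by (simp add: power3_eq_cube power2_eq_square field_simps)
  also have "real n - 2 * a = sign_sum n x"
    by (simp add: sign_sum_def a_def sum_subtractf sum_distrib_left)
  finally show ?thesis .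
qed

lemma expectation_count_cubes:
  assumes "set_pmf X \<subseteq> cube n"
  shows "measure_pmf.expectation X (count_cubes n)
    = real n ^ 3 / 4 + 3 * real n / 4 * measure_pmf.expectation X (\<lambda>x. (sign_sum n x)\<^sup>2)"
proof -
  have "integrable (measure_pmf X) h" for h :: "(nat \<Rightarrow> bool) \<Rightarrow> real"
    using finite_subset[OF assms finite_cube] by (rule integrable_measure_pmf_finite)
  then show ?thesis
    unfolding count_cubes_eq by simp
qed

text \<open>Each of the n ^ 3 triples costs 2 \<epsilon>, one \<epsilon> for the AND and one for the
  OR. Dividing 2 \<epsilon> n ^ 3 by the coefficient 3 n / 4 of the squared sign sum gives 8/3
  \<epsilon> n ^ 2.\<close>

lemma pseudorandom_sign_sum:
  assumes X: "set_pmf X \<subseteq> cube n" and pr: "pseudorandom n (circuit_class n S d) \<epsilon> X"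
    and S: "1 \<le> S" "1 \<le> d" and n: "0 < n"
  shows "measure_pmf.expectation X (\<lambda>x. (sign_sum n x)\<^sup>2) \<le> real n + 8 / 3 * \<epsilon> * (real n)\<^sup>2"
proof -
  have U: "set_pmf (uniform_cube n) \<subseteq> cube n"
    unfolding uniform_cube_eq_noise by (rule set_pmf_noise)
  let ?c = "\<lambda>i j k x. of_bool (\<forall>v\<in>set [i, j, k]. x v) + (1 - of_bool (\<exists>v\<in>set [i, j, k]. x v)) :: real"
  have int: "integrable (measure_pmf Y) h" if "set_pmf Y \<subseteq> cube n" for Y and h :: "(nat \<Rightarrow> bool) \<Rightarrow> real"
    using finite_subset[OF that finite_cube] by (rule integrable_measure_pmf_finite)
  have lin: "measure_pmf.expectation Y (count_cubes n) = (\<Sum>i<n. \<Sum>j<n. \<Sum>k<n. expect Y (\<lambda>x. \<forall>v\<in>set [i, j, k]. x v) + (1 - expect Y (\<lambda>x. \<exists>v\<in>set [i, j, k]. x v)))"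
    if Y: "set_pmf Y \<subseteq> cube n" for Y
    unfolding count_cubes_def
    by (subst Bochner_Integration.integral_sum Bochner_Integration.integral_add Bochner_Integration.integral_diff, (rule int[OF Y])+)+ simp
  have "measure_pmf.expectation X (count_cubes n) \<le> (\<Sum>i<n. \<Sum>j<n. \<Sum>k<n. (expect (uniform_cube n) (\<lambda>x. \<forall>v\<in>set [i, j, k]. x v) + (1 - expect (uniform_cube n) (\<lambda>x. \<exists>v\<in>set [i, j, k]. x v))) + 2 * \<epsilon>)"
    unfolding lin[OF X]
  proof (intro sum_mono)
    fix i j k assume ijk: "i \<in> {..<n}" "j \<in> {..<n}" "k \<in> {..<n}"
    have sub: "set [i, j, k] \<subseteq> {..<n}" using ijk by simp
    have "\<bar>expect X f - expect (uniform_cube n) f\<bar> \<le> \<epsilon>" if "f \<in> circuit_class n S d" for f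
      using pr that unfolding pseudorandom_def by blast
    from this[OF clause_in_circuit_class(1)[OF sub S]] this[OF clause_in_circuit_class(2)[OF sub S]]
    show "expect X (\<lambda>x. \<forall>v\<in>set [i, j, k]. x v) + (1 - expect X (\<lambda>x. \<exists>v\<in>set [i, j, k]. x v))
      \<le> (expect (uniform_cube n) (\<lambda>x. \<forall>v\<in>set [i, j, k]. x v) + (1 - expect (uniform_cube n) (\<lambda>x. \<exists>v\<in>set [i, j, k]. x v))) + 2 * \<epsilon>"
      unfolding abs_le_iff by linarith
  qed
  also have "\<dots> = measure_pmf.expectation (uniform_cube n) (count_cubes n) + 2 * \<epsilon> * real n ^ 3"
    unfolding lin[OF U] sum.distrib[of _ "\<lambda>_. 2 * \<epsilon>"] by (simp add: sum.distrib power3_eq_cube)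
  finally have "3 * real n / 4 * measure_pmf.expectation X (\<lambda>x. (sign_sum n x)\<^sup>2)
    \<le> 3 * real n / 4 * measure_pmf.expectation (uniform_cube n) (\<lambda>x. (sign_sum n x)\<^sup>2) + 2 * \<epsilon> * real n ^ 3"
    unfolding expectation_count_cubes[OF X] expectation_count_cubes[OF U] by simp
  also have "measure_pmf.expectation (uniform_cube n) (\<lambda>x. (sign_sum n x)\<^sup>2) = real n"
    unfolding uniform_cube_eq_noise using expectation_sign_sum[of 0 n] by simp
  also have "3 * real n / 4 * real n + 2 * \<epsilon> * real n ^ 3 = 3 * real n / 4 * (real n + 8 / 3 * \<epsilon> * (real n)\<^sup>2)"
    by (simp add: power3_eq_cube power2_eq_square field_simps)
  finally show ?thesis
    using n by (simp add: mult_le_cancel_left)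
qed

lemma dense_in_expectation:
  assumes "set_pmf Z \<subseteq> cube n" "set_pmf X \<subseteq> cube n" "dense_in \<delta> Z X" "\<And>x. 0 \<le> h x"
  shows "\<delta> * measure_pmf.expectation Z h \<le> measure_pmf.expectation X h"
proof -
  have "\<delta> * (\<Sum>x\<in>cube n. h x * pmf Z x) = (\<Sum>x\<in>cube n. h x * (\<delta> * pmf Z x))"
    by (simp add: sum_distrib_left mult_ac)
  also have "\<dots> \<le> (\<Sum>x\<in>cube n. h x * pmf X x)"
    using assms(3,4) unfolding dense_in_def by (intro sum_mono mult_left_mono) auto
  finally show ?thesis
    using assms(1,2) by (simp add: expectation_cube)
qed

text \<open>Density would give 4 \<epsilon> n ^ 2 \<le> n + 8/3 \<epsilon> n ^ 2, hence \<epsilon> n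
  \<le> 3/4. The assumption \<epsilon> \<le> \<delta>/4 makes \<alpha> at most 1/2.\<close>

lemma noise_not_dense:
  assumes \<epsilon>: "0 < \<epsilon>" "\<epsilon> \<le> \<delta> / 4" and n: "1 \<le> \<epsilon> * real n" and S: "1 \<le> S" "1 \<le> d"
    and X: "set_pmf X \<subseteq> cube n" "pseudorandom n (circuit_class n S d) \<epsilon> X"
  shows "\<not> dense_in \<delta> (noise n (sqrt (\<epsilon> / \<delta>))) X"
proof
  let ?\<alpha> = "sqrt (\<epsilon> / \<delta>)"
  assume "dense_in \<delta> (noise n ?\<alpha>) X"
  then have "\<delta> * measure_pmf.expectation (noise n ?\<alpha>) (\<lambda>x. (sign_sum n x)\<^sup>2)
      \<le> measure_pmf.expectation X (\<lambda>x. (sign_sum n x)\<^sup>2)"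
    by (intro dense_in_expectation[OF set_pmf_noise X(1)]) auto
  also have "\<dots> \<le> real n + 8 / 3 * \<epsilon> * (real n)\<^sup>2"
    using n by (intro pseudorandom_sign_sum[OF X S]) (auto intro!: gr0I)
  finally have le: "\<delta> * measure_pmf.expectation (noise n ?\<alpha>) (\<lambda>x. (sign_sum n x)\<^sup>2)
      \<le> real n + 8 / 3 * \<epsilon> * (real n)\<^sup>2" .
  have \<delta>: "0 < \<delta>" using \<epsilon> by simp
  have q: "\<epsilon> / \<delta> \<le> 1 / 4" "0 \<le> \<epsilon> / \<delta>" using \<epsilon> \<delta> by (simp_all add: field_simps)
  have \<alpha>: "0 \<le> ?\<alpha>" "?\<alpha> \<le> 1 / 2"
    using q(2) real_sqrt_le_mono[OF q(1)] by (simp, simp add: real_sqrt_divide)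
  have "\<delta> * (4 * (\<epsilon> / \<delta>) * (real n)\<^sup>2) \<le> \<delta> * (real n * (1 - 4 * (\<epsilon> / \<delta>)) + 4 * (\<epsilon> / \<delta>) * (real n)\<^sup>2)"
    using q \<delta> by (intro mult_left_mono) auto
  also have "\<dots> = \<delta> * measure_pmf.expectation (noise n ?\<alpha>) (\<lambda>x. (sign_sum n x)\<^sup>2)"
    using expectation_sign_sum[OF \<alpha>, of n] q by simp
  also note le
  finally have "4 / 3 * (\<epsilon> * real n) * real n \<le> real n"
    using \<delta> by (simp add: power2_eq_square field_simps)
  moreover have "real n > 0" using n by (auto intro!: gr0I)
  ultimately have "4 / 3 * (\<epsilon> * real n) \<le> 1"
    using mult_le_cancel_right_pos[of "real n" "4 / 3 * (\<epsilon> * real n)" 1] by simp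
  then show False using n by simp
qed

section \<open>Choice of the parameters\<close>

text \<open>For S \<ge> 2 the logarithm is at least 1, so rounding up and the successor cost a
  factor 3. The 5 bounds 3 / ln 2.\<close>

lemma switching_size:
  assumes "2 \<le> S"
  shows "\<exists>r. 3 * S \<le> 4 ^ Suc r \<and> real (Suc r) \<le> 5 * ln (real S)"
proof -
  define r where "r = nat \<lceil>log 2 (real S)\<rceil>"
  have l1: "1 \<le> log 2 (real S)"
    using assms by (simp add: le_log_iff)
  then have r: "log 2 (real S) \<le> real r" "real r \<le> log 2 (real S) + 1"
    unfolding r_def by linarith+
  have "real S \<le> 2 powr real r"
    using r(1) assms by (simp add: log_le_iff)
  then have "real S \<le> 2 ^ r" by (simp add: powr_realpow)
  then have S: "S \<le> 2 ^ r" by (metis of_nat_le_iff of_nat_numeral of_nat_power)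
  have "3 * S \<le> 4 * 2 ^ r * (1 :: nat)" using S by simp
  also have "\<dots> \<le> 4 * 2 ^ r * 2 ^ r" by (intro mult_left_mono) auto
  also have "\<dots> = 4 ^ Suc r"
    using power_mult_distrib[of "2 :: nat" 2 r] by simp
  finally have A: "3 * S \<le> 4 ^ Suc r" .
  have "real (Suc r) \<le> 3 * log 2 (real S)" using r(2) l1 by simp
  also have "\<dots> = 3 / ln 2 * ln (real S)" by (simp add: log_def)
  also have "\<dots> \<le> 5 * ln (real S)"
    using ln2_ge_two_thirds assms by (intro mult_right_mono) (auto simp: field_simps)
  finally show ?thesis using A by blast
qed

text \<open>Origin of the constant: 5242880 = 2048 * 2560, where 2560 = 512 * 5 comes from the star
  probability and the bound on \<open>Suc r\<close>, and 2048 = 4 * 512 from the target 4 and the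
  first restriction. Since d - 1 \<ge> 1, the factor 2048 may be raised to that power too.\<close>

lemma restriction_rate_bound:
  fixes x l :: real
  assumes S: "2 \<le> S" "real S \<le> exp (1 / 5242880 * x powr (1 / (real d - 1)))" and d: "2 \<le> d"
    and x: "0 < x" and r: "real (Suc r) \<le> 5 * ln (real S)"
  shows "4 \<le> x * (1 / 512 * (1 / (512 * real (Suc r))) ^ (d - 1))"
proof -
  define e where "e = d - 1"
  have e: "1 \<le> e" "real d - 1 = real e" using d by (auto simp: e_def)
  define l where "l = ln (real S)"
  have l: "0 < l" using S(1) by (simp add: l_def)
  have "l \<le> 1 / 5242880 * x powr (1 / real e)"
    using ln_mono[OF S(2)] S(1) by (simp add: l_def e(2))
  then have "5242880 * l \<le> x powr (1 / real e)" by simp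
  then have "(5242880 * l) ^ e \<le> (x powr (1 / real e)) ^ e"
    using l by (intro power_mono) auto
  also have "\<dots> = x"
    using e(1) x by (simp add: powr_realpow[symmetric] powr_powr)
  finally have "(5242880 * l) ^ e \<le> x" .
  moreover have "2048 * (2560 * l) ^ e \<le> (5242880 * l) ^ e"
  proof -
    have "(2048 :: real) ^ 1 \<le> 2048 ^ e" using e(1) by (intro power_increasing) auto
    then have "2048 * (2560 * l) ^ e \<le> 2048 ^ e * (2560 * l) ^ e"
      using l by (intro mult_right_mono) auto
    also have "\<dots> = (5242880 * l) ^ e"
      using power_mult_distrib[of 2048 "2560 * l" e, symmetric] by simp
    finally show ?thesis .
  qed
  moreover have "2048 * (512 * real (Suc r)) ^ e \<le> 2048 * (2560 * l) ^ e"
    using r by (intro mult_left_mono power_mono) (auto simp: l_def)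
  ultimately have "2048 * (512 * real (Suc r)) ^ e \<le> x" by linarith
  then have "4 \<le> x * (1 / 512 / (512 * real (Suc r)) ^ e)"
    by (simp add: field_simps del: of_nat_Suc)
  then show ?thesis
    unfolding e_def[symmetric] by (simp add: power_one_over)
qed

theorem theorem1p5:
  shows "\<exists>c\<^sub>0 C :: real. c\<^sub>0 > 0 \<and> C > 0 \<and>
    (\<forall>(\<epsilon>::real) (\<epsilon>'::real) (\<delta>::real) (d::nat) (S::nat).
       \<epsilon> > 0 \<longrightarrow> \<epsilon>' > 0 \<longrightarrow> \<delta> > 0 \<longrightarrow> \<delta> < 1 \<longrightarrow> \<epsilon> \<le> \<delta> / 4 \<longrightarrow> d \<ge> 2 \<longrightarrow> S \<ge> 2 \<longrightarrow>
       real S \<le> exp (c\<^sub>0 * (sqrt \<delta> / sqrt \<epsilon> * (log 2 (1 / \<delta>) / log 2 (1 / \<epsilon>')))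
                          powr (1 / (real d - 1))) \<longrightarrow>
       (\<exists>n::nat. real n \<le> C / \<epsilon> \<and>
          pseudodense n (circuit_class n S d) \<epsilon>' \<delta> (noise n (sqrt (\<epsilon> / \<delta>))) \<and>
          \<not> (\<exists>X. set_pmf X \<subseteq> cube n \<and> pseudorandom n (circuit_class n S d) \<epsilon> X \<and>
                 dense_in \<delta> (noise n (sqrt (\<epsilon> / \<delta>))) X)))"
proof (rule exI[of _ "1 / 5242880"], rule exI[of _ 2], intro conjI allI impI)
  fix \<epsilon> \<epsilon>' \<delta> :: real and d S :: nat
  assume \<epsilon>: "\<epsilon> > 0" and \<epsilon>': "\<epsilon>' > 0" and \<delta>: "\<delta> > 0" "\<delta> < 1" and \<epsilon>\<delta>: "\<epsilon> \<le> \<delta> / 4"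
    and d: "d \<ge> 2" and S: "S \<ge> 2"
    and size: "real S \<le> exp (1 / 5242880 * (sqrt \<delta> / sqrt \<epsilon> * (log 2 (1 / \<delta>) / log 2 (1 / \<epsilon>'))) powr (1 / (real d - 1)))"
  define \<alpha> where "\<alpha> = sqrt (\<epsilon> / \<delta>)"
  have \<alpha>: "0 < \<alpha>" using \<epsilon> \<delta> by (simp add: \<alpha>_def)
  define n where "n = nat \<lceil>1 / \<epsilon>\<rceil>"
  have n: "1 / \<epsilon> \<le> real n" "real n \<le> 1 / \<epsilon> + 1"
    using \<epsilon> of_nat_ceiling[of "1 / \<epsilon>"] of_int_ceiling_le_add_one[of "1 / \<epsilon>"]
    unfolding n_def by simp_all
  have dense: "pseudodense n (circuit_class n S d) \<epsilon>' \<delta> (noise n \<alpha>)"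
  proof (cases "\<delta> \<le> \<epsilon>'")
    case True
    then show ?thesis using \<delta> by (intro pseudodense_of_le) auto
  next
    case False
    define L where "L = log 2 (1 / \<delta>)"
    define M where "M = log 2 (1 / \<epsilon>')"
    have L: "0 < L" using \<delta> by (simp add: L_def)
    have "1 / \<delta> \<le> 1 / \<epsilon>'" using False \<epsilon>' by (intro divide_left_mono) auto
    then have M: "L \<le> M" using \<delta> \<epsilon>' by (simp add: L_def M_def)
    have \<delta>L: "\<delta> = 2 powr (- L)" using \<delta> by (simp add: L_def log_divide)
    have \<epsilon>M: "\<epsilon>' = 2 powr (- M)" using \<epsilon>' by (simp add: M_def log_divide)
    obtain r where r: "3 * S \<le> 4 ^ Suc r" "real (Suc r) \<le> 5 * ln (real S)"
      using switching_size[OF S] by blast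
    define p where "p = 1 / 512 * (1 / (512 * real (Suc r))) ^ (d - 1)"
    have p0: "0 < p" by (simp add: p_def)
    have "sqrt \<delta> / sqrt \<epsilon> = 1 / \<alpha>"
      by (simp add: \<alpha>_def real_sqrt_divide)
    then have x: "sqrt \<delta> / sqrt \<epsilon> * (log 2 (1 / \<delta>) / log 2 (1 / \<epsilon>')) = L / (\<alpha> * M)"
      by (simp add: L_def M_def)
    have "4 \<le> L / (\<alpha> * M) * p"
      unfolding p_def
    proof (rule restriction_rate_bound[OF S _ d _ r(2)])
      show "real S \<le> exp (1 / 5242880 * (L / (\<alpha> * M)) powr (1 / (real d - 1)))"
        using size unfolding x .
      show "0 < L / (\<alpha> * M)"
        using L M \<alpha> by simp
    qed
    then have key: "4 * (\<alpha> * M) \<le> L * p"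
      using L M \<alpha> by (simp add: field_simps)
    \<comment> \<open>Here L \<le> M, that is \<open>\<epsilon>' < \<delta>\<close>, turns the bound
      on \<alpha> M into one on \<alpha> alone.\<close>
    have "4 * (\<alpha> * L) \<le> 4 * (\<alpha> * M)"
      using M \<alpha> by (intro mult_left_mono) auto
    with key have "L * (4 * \<alpha>) \<le> L * p" by (simp add: mult_ac)
    then have "4 * \<alpha> \<le> p" using L by simp
    then have 1: "2 * \<alpha> \<le> p" using \<alpha> by simp
    have "2 * \<alpha> * M \<le> 1 / 2 * (L * p)" using key by simp
    also have "\<dots> \<le> ln 2 * (L * p)"
      using L p0 ln2_ge_two_thirds by (intro mult_right_mono) auto
    finally have 2: "2 * \<alpha> * M \<le> p * (L * ln 2)" by (simp add: mult_ac)
    show ?thesis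
      unfolding \<epsilon>M using S r(1) L M \<alpha> 1 2
      by (intro pseudodense_noise[OF d _ r(1) \<delta>L L _ _ p_def]) auto
  qed
  have "1 \<le> \<epsilon> * real n" using n(1) \<epsilon> by (simp add: field_simps)
  then have "\<not> dense_in \<delta> (noise n (sqrt (\<epsilon> / \<delta>))) X"
    if "set_pmf X \<subseteq> cube n" "pseudorandom n (circuit_class n S d) \<epsilon> X" for X
    using S d that by (intro noise_not_dense[OF \<epsilon> \<epsilon>\<delta>]) auto
  moreover have "real n \<le> 2 / \<epsilon>"
  proof -
    \<comment> \<open>As \<epsilon> < 1, rounding 1 / \<epsilon> up at most doubles it; hence C =
      2.\<close>
    have "1 \<le> 1 / \<epsilon>" using \<epsilon> \<epsilon>\<delta> \<delta> by (simp add: field_simps)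
    then show ?thesis using n(2) by simp
  qed
  ultimately show "\<exists>n::nat. real n \<le> 2 / \<epsilon> \<and>
      pseudodense n (circuit_class n S d) \<epsilon>' \<delta> (noise n (sqrt (\<epsilon> / \<delta>))) \<and>
      \<not> (\<exists>X. set_pmf X \<subseteq> cube n \<and> pseudorandom n (circuit_class n S d) \<epsilon> X \<and>
             dense_in \<delta> (noise n (sqrt (\<epsilon> / \<delta>))) X)"
    using dense unfolding \<alpha>_def by blast
qed simp_all

end
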